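(* Let $n$ be an integer with $1<n\le 4$ and let $k\in\mathbb N$ ($k\ge 1$). Let $f:\mathbb R\to\mathbb R$ be continuous and odd, $f(0)=0$, and put $F(s)=\int_0^s f(t)\,dt$. Assume that there exist $\beta>b>0$ such that $f(s)>0$ for $s>b$, $f(s)\le 0$ for $s\in[0,b]$, $f\not\equiv 0$ on $[0,b]$, and $F(\beta)=0$. Assume also that $f$ is continuously differentiable in $(0,\infty)$ and $f'\in L^1(0,1)$. If in addition $$\Bigl(\frac{F}{f}\Bigr)'(s)\ge \frac{n-2}{2}\qquad\text{for all } s>\beta,$$ then the problem $$u''(r)+\frac{n-1}{r}u'(r)+f(u(r))=0\quad (r>0),\qquad u'(0)=0,\qquad \lim_{r\to\infty}u(r)=0$$ has at most one solution satisfying $u(0)>0$ which has exactly $k-1$ sign changes in $(0,\infty)$.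
   Context: Solutions are $C^2$ functions $u$ on $[0,\infty)$; $'$ on $u$ denotes $d/dr$. The problem is the radial form of $\Delta u+f(u)=0$ in $\mathbb R^n$. *)

theory Defs
  imports "HOL-Analysis.Analysis"
begin

text \<open>The oriented integral, so \<open>primitive f s\<close> is also right for negative \<open>s\<close>.\<close>

definition primitive :: "(real \<Rightarrow> real) \<Rightarrow> real \<Rightarrow> real" where
  "primitive f s = (LBINT t=ereal 0..ereal s. f t)"

text \<open>
  \<open>u\<close> is \<open>C\<^sup>2\<close> on \<open>[0,\<infinity>)\<close>, with one-sided derivatives at \<open>0\<close>. The derivatives \<open>u1\<close>, \<open>u2\<close>
  are determined by \<open>u\<close> on \<open>[0,\<infinity>)\<close>; values of \<open>u\<close> on negative reals play no role.
\<close>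

definition radial_solution :: "nat \<Rightarrow> (real \<Rightarrow> real) \<Rightarrow> (real \<Rightarrow> real) \<Rightarrow> bool" where
  "radial_solution n f u \<longleftrightarrow>
    (\<exists>u1 u2.
      (\<forall>r\<ge>0. (u has_real_derivative u1 r) (at r within {0..})) \<and>
      (\<forall>r\<ge>0. (u1 has_real_derivative u2 r) (at r within {0..})) \<and>
      continuous_on {0..} u2 \<and>
      (\<forall>r>0. u2 r + (real n - 1) / r * u1 r + f (u r) = 0) \<and>
      u1 0 = 0 \<and>
      (u \<longlongrightarrow> 0) at_top)"

text \<open>
  The number of sign changes in \<open>(0,\<infinity>)\<close> is the largest \<open>m\<close> for which there are points
  \<open>0 < r\<^sub>0 < \<dots> < r\<^sub>m\<close> with values of \<open>u\<close> of opposite sign at consecutive points. Zeros without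
  a change of sign do not count, and \<open>u\<close> may vanish on intervals.
\<close>

definition at_least_sign_changes :: "(real \<Rightarrow> real) \<Rightarrow> nat \<Rightarrow> bool" where
  "at_least_sign_changes u m \<longleftrightarrow>
    (\<exists>r :: nat \<Rightarrow> real. (\<forall>i\<le>m. 0 < r i) \<and>
       (\<forall>i<m. r i < r (Suc i) \<and> u (r i) * u (r (Suc i)) < 0))"

definition exactly_sign_changes :: "(real \<Rightarrow> real) \<Rightarrow> nat \<Rightarrow> bool" where
  "exactly_sign_changes u m \<longleftrightarrow>
    at_least_sign_changes u m \<and> \<not> at_least_sign_changes u (Suc m)"

end

theory Submission
  imports Defs
begin

text \<open>
  Between consecutive critical points a solution is monotone and can be described, with the level
  \<open>s = u\<close> as independent variable, by the radius \<open>r(s)\<close> and the speed \<open>p(s) = |u'|\<close>. Two solutions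
  with \<open>u(0) < v(0)\<close> are compared level by level. While \<open>v\<close> lags behind (\<open>r\<^sub>1 < r\<^sub>2\<close>), the quantity
  \<open>(p\<^sub>2\<^sup>2 - p\<^sub>1\<^sup>2) r\<^sub>1\<^sup>n\<^sup>-\<^sup>1\<close> grows along the descent, so \<open>v\<close> stays faster. Once \<open>v\<close> has
  overtaken, this is preserved at the levels \<open>|s| \<le> \<beta>\<close> by \<open>W = r (u'\<^sup>2 + 2F)\<^sup>1\<^sup>/\<^sup>2\<close>, and at the
  levels \<open>|s| > \<beta>\<close> by \<open>Q = r\<^sup>2 (u'\<^sup>2 + 2F) + 4 r u' F/f + G(u)\<close> with \<open>G' = 4 (n-2) F/f\<close>, for which
  \<open>dQ/dr = 4 r u'\<^sup>2 ((F/f)' - (n-2)/2) \<ge> 0\<close>. Hence at each critical point \<open>|v|\<close> is larger and \<open>Q\<close> is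
  larger for \<open>v\<close>, and induction over the monotone pieces reaches the last one, on which the energy
  \<open>u'\<^sup>2 + 2F\<close> of both solutions tends to \<open>0\<close>. There either alternative is contradictory: a lagging
  \<open>v\<close> would have energy at least \<open>c r\<^sup>1\<^sup>-\<^sup>n\<close>, although energy decays like \<open>r\<^sup>2\<^sup>-\<^sup>2\<^sup>n\<close>; and if \<open>v\<close> has
  overtaken, its \<open>W\<close> stays bounded away from \<open>0\<close>, so that \<open>v\<close> reaches \<open>0\<close> within bounded radius with
  positive energy.
\<close>

section \<open>Continuous functions of one variable\<close>

lemma first_failure:
  fixes g :: "real \<Rightarrow> real"
  assumes "continuous_on {a..c} g" "a \<le> c" "0 < g c" "\<not> 0 < g a"
  obtains e where "a \<le> e" "e < c" "g e = 0" "\<And>s. e < s \<Longrightarrow> s \<le> c \<Longrightarrow> 0 < g s"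
proof -
  define S where "S = {a..c} \<inter> g -` {..0}"
  have "closed S" unfolding S_def
    using continuous_closed_preimage[OF assms(1) closed_real_atLeastAtMost closed_atMost] .
  moreover have "bounded S" by (rule bounded_subset[OF bounded_closed_interval]) (auto simp: S_def)
  ultimately have "compact S" by (simp add: compact_eq_bounded_closed)
  moreover have "a \<in> S" using assms by (auto simp: S_def)
  ultimately obtain e where e: "e \<in> S" "\<And>s. s \<in> S \<Longrightarrow> s \<le> e"
    using compact_attains_sup[of S] by auto
  have pos: "0 < g s" if "e < s" "s \<le> c" for s
    using e(2)[of s] that e(1) by (force simp: S_def)
  have ec: "e < c" using e(1) assms(3) by (auto simp: S_def order_le_less)
  have "\<exists>x\<ge>e. x \<le> c \<and> g x = 0"
    using e(1) ec assms(1,3) by (intro IVT') (auto simp: S_def intro: continuous_on_subset)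
  then obtain x where "e \<le> x" "x \<le> c" "g x = 0" by blast
  then have "x = e" using pos[of x] by (cases "x = e") auto
  then show ?thesis using that[of e] e(1) ec pos \<open>g x = 0\<close> by (auto simp: S_def)
qed

lemma zero_if_halved:
  fixes h :: "real \<Rightarrow> real"
  assumes "continuous_on {a..c} h" "a \<le> c"
    and halve: "\<And>D t. (\<And>s. s \<in> {a..c} \<Longrightarrow> \<bar>h s\<bar> \<le> D) \<Longrightarrow> t \<in> {a..c} \<Longrightarrow> \<bar>h t\<bar> \<le> D / 2"
    and "t \<in> {a..c}"
  shows "h t = 0"
proof -
  have "continuous_on {a..c} (\<lambda>s. \<bar>h s\<bar>)" using assms(1) by (intro continuous_intros)
  then obtain s where s: "s \<in> {a..c}" "\<And>t. t \<in> {a..c} \<Longrightarrow> \<bar>h t\<bar> \<le> \<bar>h s\<bar>"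
    using continuous_attains_sup[of "{a..c}" "\<lambda>s. \<bar>h s\<bar>"] assms(2) by auto
  have "\<bar>h s\<bar> \<le> \<bar>h s\<bar> / 2" using halve[OF s(2) s(1)] .
  then show ?thesis using s(2)[OF assms(4)] by simp
qed

lemma continuous_near:
  fixes h :: "real \<Rightarrow> real"
  assumes "continuous_on {0..} h" "0 \<le> e" "0 < \<epsilon>"
  obtains \<delta> where "0 < \<delta>" "\<And>t. e \<le> t \<Longrightarrow> t \<le> e + \<delta> \<Longrightarrow> \<bar>h t - h e\<bar> < \<epsilon>"
proof -
  have cont: "continuous (at e within {0..}) h"
    using assms(1,2) by (auto simp: continuous_on_eq_continuous_within)
  obtain d where d: "0 < d" "\<And>x. x \<in> {0..} \<Longrightarrow> dist x e < d \<Longrightarrow> dist (h x) (h e) < \<epsilon>"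
    using cont[unfolded continuous_within_eps_delta, rule_format, OF assms(3)] by blast
  show ?thesis
    by (rule that[of "d / 2"]) (use d assms(2) in \<open>auto simp: dist_real_def\<close>)
qed

lemma lipschitz_of_deriv:
  fixes h h' :: "real \<Rightarrow> real"
  assumes "\<And>t. t \<in> {a..c} \<Longrightarrow> (h has_real_derivative h' t) (at t within {a..c})"
    and "\<And>t. t \<in> {a..c} \<Longrightarrow> \<bar>h' t\<bar> \<le> B" and "x \<in> {a..c}" "y \<in> {a..c}"
  shows "\<bar>h x - h y\<bar> \<le> B * \<bar>x - y\<bar>"
  using field_differentiable_bound[of "{a..c}" h h' B x y] assms by simp

section \<open>Monotone pieces parametrised by the level\<close>

locale radial_ode =
  fixes n :: nat and f F :: "real \<Rightarrow> real" and b \<beta> :: real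
  assumes n_ge: "2 \<le> n"
    and f_cont: "continuous_on UNIV f"
    and f_C1: "f C1_differentiable_on {0<..}"
    and f_odd: "f (- s) = - f s"
    and F_deriv: "(F has_real_derivative f s) (at s)"
    and F_even: "F (- s) = F s"
    and F_0: "F 0 = 0"
    and b_pos: "0 < b" and b_less: "b < \<beta>"
    and f_pos: "b < s \<Longrightarrow> 0 < f s"
    and F_nonpos: "\<bar>s\<bar> \<le> \<beta> \<Longrightarrow> F s \<le> 0"
    and F_pos: "\<beta> < \<bar>s\<bar> \<Longrightarrow> 0 < F s"
    and quotient_deriv: "\<beta> < s \<Longrightarrow>
      \<exists>d\<ge>(real n - 2) / 2. ((\<lambda>t. F t / f t) has_real_derivative d) (at s)"
begin

lemma beta_pos: "0 < \<beta>" using b_pos b_less by simp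

lemma F_cont: "continuous_on S F"
  by (meson DERIV_continuous F_deriv continuous_at_imp_continuous_on)

lemma F_abs: "F \<bar>s\<bar> = F s" using F_even[of s] by (cases "s \<ge> 0") auto

lemma F_beta: "F \<beta> = 0"
proof -
  have "(F \<longlongrightarrow> F \<beta>) (at_right \<beta>)"
    using F_cont[of UNIV] beta_pos
    by (meson DERIV_isCont F_deriv filterlim_at_split isContD)
  moreover have "eventually (\<lambda>s. 0 \<le> F s) (at_right \<beta>)"
    using eventually_at_right_less[of \<beta>]
  proof eventually_elim
    case (elim s) then show ?case using F_pos[of s] beta_pos by simp
  qed
  ultimately have "0 \<le> F \<beta>" by (rule tendsto_lowerbound) simp
  moreover have "F \<beta> \<le> 0" using F_nonpos[of \<beta>] beta_pos by simp
  ultimately show ?thesis by simp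
qed

lemma f_nz: "b < \<bar>s\<bar> \<Longrightarrow> f s \<noteq> 0"
  using f_pos[of s] f_pos[of "-s"] f_odd[of s] by (cases "s \<ge> 0") auto

lemma quotient_cont: "S \<subseteq> {s. \<beta> \<le> \<bar>s\<bar>} \<Longrightarrow> continuous_on S (\<lambda>s. F s / f s)"
  using f_nz b_less
  by (intro continuous_intros F_cont continuous_on_subset[OF f_cont]) force+

lemma quotient_deriv_abs:
  assumes "\<beta> < \<bar>s\<bar>"
  shows "\<exists>d\<ge>(real n - 2) / 2. ((\<lambda>t. F t / f t) has_real_derivative d) (at s)"
proof (cases "s > 0")
  case True then show ?thesis using quotient_deriv[of s] assms by simp
next
  case False
  then obtain d where d: "d \<ge> (real n - 2) / 2" "((\<lambda>t. F t / f t) has_real_derivative d) (at (- s))"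
    using quotient_deriv[of "-s"] assms by auto
  have "((\<lambda>t. - (F (- t) / f (- t))) has_real_derivative - (d * - 1)) (at s)"
    by (intro DERIV_minus DERIV_chain2[where f = "\<lambda>t. F t / f t" and g = uminus, OF d(2)] derivative_eq_intros refl)
  then have "((\<lambda>t. F t / f t) has_real_derivative d) (at s)"
    by (simp add: F_even f_odd)
  with d(1) show ?thesis by blast
qed

definition G :: "real \<Rightarrow> real" where
  "G s = 4 * (real n - 2) * integral {\<beta>..\<bar>s\<bar>} (\<lambda>t. F t / f t)"

lemma G_even: "G (- s) = G s" by (simp add: G_def)

lemma G_deriv_pos:
  assumes "\<beta> < s"
  shows "(G has_real_derivative 4 * (real n - 2) * (F s / f s)) (at s)"
proof -
  have "((\<lambda>x. integral {\<beta>..x} (\<lambda>t. F t / f t)) has_real_derivative F s / f s)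
      (at s within {\<beta>..s+1})"
    using assms beta_pos by (intro integral_has_real_derivative quotient_cont) auto
  then have "((\<lambda>x. integral {\<beta>..x} (\<lambda>t. F t / f t)) has_real_derivative F s / f s) (at s)"
    using assms at_within_Icc_at[of \<beta> s "s+1"] by simp
  then have "((\<lambda>x. 4 * (real n - 2) * integral {\<beta>..x} (\<lambda>t. F t / f t))
      has_real_derivative 4 * (real n - 2) * (F s / f s)) (at s)"
    by (intro derivative_eq_intros) auto
  then show ?thesis
  proof (rule has_field_derivative_transform_within_open[of _ _ _ "{0<..}"])
  qed (use assms beta_pos in \<open>auto simp: G_def\<close>)
qed

lemma G_deriv:
  assumes "\<beta> < \<bar>s\<bar>"
  shows "(G has_real_derivative 4 * (real n - 2) * (F s / f s)) (at s)"
proof (cases "s > 0")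
  case True then show ?thesis using G_deriv_pos assms by simp
next
  case False
  have "((\<lambda>t. G (- t)) has_real_derivative (4 * (real n - 2) * (F (-s) / f (-s))) * - 1) (at s)"
    using False assms by (intro DERIV_chain2[OF G_deriv_pos] derivative_eq_intros refl) auto
  then show ?thesis by (simp add: G_even F_even f_odd)
qed

lemma G_cont: "S \<subseteq> {s. \<beta> \<le> \<bar>s\<bar>} \<Longrightarrow> continuous_on S G"
proof -
  assume S: "S \<subseteq> {s. \<beta> \<le> \<bar>s\<bar>}"
  have *: "continuous_on {\<beta>..c} (\<lambda>x. integral {\<beta>..x} (\<lambda>t. F t / f t))" for c
    using beta_pos by (intro indefinite_integral_continuous_1 integrable_continuous_interval quotient_cont) auto
  have "continuous_on {\<beta>..} (\<lambda>x. integral {\<beta>..x} (\<lambda>t. F t / f t))"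
    unfolding continuous_on_eq_continuous_within
  proof
    fix x assume x: "x \<in> {\<beta>..}"
    have "continuous (at x within {\<beta>..x+1}) (\<lambda>x. integral {\<beta>..x} (\<lambda>t. F t / f t))"
      using *[of "x+1"] x by (auto simp: continuous_on_eq_continuous_within)
    moreover have "at x within {\<beta>..x+1} = at x within {\<beta>..}"
      by (rule at_within_nhd[of _ "{..<x+1}"]) auto
    ultimately show "continuous (at x within {\<beta>..}) (\<lambda>x. integral {\<beta>..x} (\<lambda>t. F t / f t))" by simp
  qed
  then have "continuous_on S (\<lambda>s. integral {\<beta>..\<bar>s\<bar>} (\<lambda>t. F t / f t))"
    by (rule continuous_on_compose2) (use S in \<open>auto intro!: continuous_intros\<close>)
  then show ?thesis unfolding G_def by (intro continuous_intros)
qed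

lemma G_beta: "\<bar>s\<bar> = \<beta> \<Longrightarrow> G s = 0" by (simp add: G_def)

lemma G_mono:
  assumes "\<beta> \<le> x" "x \<le> y"
  shows "G x \<le> G y"
proof (rule DERIV_nonneg_imp_increasing_open[OF assms(2)])
  show "continuous_on {x..y} G" using assms beta_pos by (intro G_cont) auto
  fix z assume z: "x < z" "z < y"
  have "0 \<le> 4 * (real n - 2) * (F z / f z)"
    using F_pos[of z] f_pos[of z] b_less beta_pos z assms n_ge by (intro mult_nonneg_nonneg divide_nonneg_nonneg) auto
  then show "\<exists>d. (G has_real_derivative d) (at z) \<and> 0 \<le> d"
    using G_deriv_pos[of z] z assms by auto
qed

definition flow_at :: "(real \<Rightarrow> real) \<Rightarrow> (real \<Rightarrow> real) \<Rightarrow> real \<Rightarrow> bool" where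
  "flow_at r p s \<longleftrightarrow> 0 < r s \<and> 0 < p s \<and> (r has_real_derivative - 1 / p s) (at s) \<and>
    (p has_real_derivative (real n - 1) / r s - f s / p s) (at s)"

definition flow_on :: "(real \<Rightarrow> real) \<Rightarrow> (real \<Rightarrow> real) \<Rightarrow> real \<Rightarrow> real \<Rightarrow> bool" where
  "flow_on r p a c \<longleftrightarrow> continuous_on {a..c} r \<and> continuous_on {a..c} p \<and>
    (\<forall>s\<in>{a..c}. 0 \<le> r s \<and> 0 \<le> p s \<and> 0 < (p s)\<^sup>2 + 2 * F s) \<and> (\<forall>s\<in>{a<..<c}. flow_at r p s)"

lemma flow_on_sub: "flow_on r p a c \<Longrightarrow> a \<le> a' \<Longrightarrow> c' \<le> c \<Longrightarrow> flow_on r p a' c'"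
  unfolding flow_on_def by (auto intro: continuous_on_subset)

text \<open>Since \<open>u' = - p\<close>, the middle term of \<open>Q\<close> has a minus sign.\<close>

definition Q :: "(real \<Rightarrow> real) \<Rightarrow> (real \<Rightarrow> real) \<Rightarrow> real \<Rightarrow> real" where
  "Q r p s = (r s)\<^sup>2 * ((p s)\<^sup>2 + 2 * F s) - 4 * (r s * p s) * (F s / f s) + G s"

definition W :: "(real \<Rightarrow> real) \<Rightarrow> (real \<Rightarrow> real) \<Rightarrow> real \<Rightarrow> real" where
  "W r p s = r s * sqrt ((p s)\<^sup>2 + 2 * F s)"

lemma Q_deriv:
  assumes "\<beta> < \<bar>s\<bar>"
  shows "\<exists>h\<ge>0. \<forall>r p. flow_at r p s \<longrightarrow> (Q r p has_real_derivative - (4 * (r s * p s) * h)) (at s)"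
proof -
  obtain d where d: "d \<ge> (real n - 2) / 2" "((\<lambda>t. F t / f t) has_real_derivative d) (at s)"
    using quotient_deriv_abs[OF assms] by blast
  have fnz: "f s \<noteq> 0" using f_nz assms b_less by simp
  have "(Q r p has_real_derivative - (4 * (r s * p s) * (d - (real n - 2) / 2))) (at s)"
    if fl: "flow_at r p s" for r p
  proof -
    have *: "0 < r s" "0 < p s" "(r has_real_derivative - 1 / p s) (at s)"
      "(p has_real_derivative (real n - 1) / r s - f s / p s) (at s)"
      using fl by (auto simp: flow_at_def)
    define q where "q = (\<lambda>t. F t / f t)"
    have q: "(q has_real_derivative d) (at s)" using d(2) by (simp add: q_def)
    have Fq: "F s = q s * f s" using fnz by (simp add: q_def)
    have "(\<lambda>s. (r s)\<^sup>2 * ((p s)\<^sup>2 + 2 * F s) - 4 * (r s * p s) * q s + G s) = Q r p"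
      by (simp add: fun_eq_iff Q_def q_def)
    moreover have "((\<lambda>s. (r s)\<^sup>2 * ((p s)\<^sup>2 + 2 * F s) - 4 * (r s * p s) * q s + G s) has_real_derivative
       (2 * r s * (- 1 / p s) * ((p s)\<^sup>2 + 2 * F s) + (r s)\<^sup>2 * (2 * p s * ((real n - 1) / r s - f s / p s) + 2 * f s)
        - (4 * (- 1 / p s * p s + r s * ((real n - 1) / r s - f s / p s)) * q s + 4 * (r s * p s) * d)
        + 4 * (real n - 2) * q s)) (at s)"
      by (rule derivative_eq_intros *(3,4) F_deriv q G_deriv[OF assms, folded q_def] refl
          | simp add: q_def algebra_simps)+
    moreover have "(2 * r s * (- 1 / p s) * ((p s)\<^sup>2 + 2 * F s) + (r s)\<^sup>2 * (2 * p s * ((real n - 1) / r s - f s / p s) + 2 * f s)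
        - (4 * (- 1 / p s * p s + r s * ((real n - 1) / r s - f s / p s)) * q s + 4 * (r s * p s) * d)
        + 4 * (real n - 2) * q s) = - (4 * (r s * p s) * (d - (real n - 2) / 2))"
      unfolding Fq using *(1,2) by (simp add: field_simps power2_eq_square)
    ultimately show ?thesis by metis
  qed
  moreover have "d - (real n - 2) / 2 \<ge> 0" using d by simp
  ultimately show ?thesis by blast
qed

lemma Q_cont:
  assumes "flow_on r p a c" "{a..c} \<subseteq> {s. \<beta> \<le> \<bar>s\<bar>}"
  shows "continuous_on {a..c} (Q r p)"
  using assms unfolding Q_def[abs_def] flow_on_def
  by (intro continuous_intros F_cont quotient_cont G_cont) auto

lemma Q_antimono:
  assumes fl: "flow_on r p a c" and "a \<le> c" and out: "\<beta> \<le> a \<or> c \<le> - \<beta>"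
  shows "Q r p c \<le> Q r p a"
proof (rule DERIV_nonpos_imp_decreasing_open[OF \<open>a \<le> c\<close>])
  fix s assume s: "a < s" "s < c"
  then have "\<beta> < \<bar>s\<bar>" using out beta_pos by auto
  then obtain h where h: "h \<ge> 0" "\<forall>r p. flow_at r p s \<longrightarrow> (Q r p has_real_derivative - (4 * (r s * p s) * h)) (at s)"
    using Q_deriv by blast
  have "flow_at r p s" using fl s by (auto simp: flow_on_def)
  with h show "\<exists>y. (Q r p has_real_derivative y) (at s) \<and> y \<le> 0"
    by (intro exI[of _ "- (4 * (r s * p s) * h)"]) (auto simp: flow_at_def)
next
  show "continuous_on {a..c} (Q r p)" using out fl beta_pos by (intro Q_cont) auto
qed

lemma Q_diff_antimono:
  assumes fl: "flow_on r1 p1 a c" "flow_on r2 p2 a c" and "a \<le> c" and out: "\<beta> \<le> a \<or> c \<le> - \<beta>"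
    and y: "\<And>s. a < s \<Longrightarrow> s < c \<Longrightarrow> r1 s * p1 s \<le> r2 s * p2 s"
  shows "Q r2 p2 c - Q r1 p1 c \<le> Q r2 p2 a - Q r1 p1 a"
proof (rule DERIV_nonpos_imp_decreasing_open[OF \<open>a \<le> c\<close>, of "\<lambda>s. Q r2 p2 s - Q r1 p1 s"])
  fix s assume s: "a < s" "s < c"
  then have "\<beta> < \<bar>s\<bar>" using out beta_pos by auto
  then obtain h where h: "h \<ge> 0" "\<forall>r p. flow_at r p s \<longrightarrow> (Q r p has_real_derivative - (4 * (r s * p s) * h)) (at s)"
    using Q_deriv by blast
  have "flow_at r1 p1 s" "flow_at r2 p2 s" using fl s by (auto simp: flow_on_def)
  then have "((\<lambda>s. Q r2 p2 s - Q r1 p1 s) has_real_derivative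
     - (4 * (r2 s * p2 s) * h) - - (4 * (r1 s * p1 s) * h)) (at s)"
    using h by (intro DERIV_diff) auto
  moreover have "- (4 * (r2 s * p2 s) * h) - - (4 * (r1 s * p1 s) * h) \<le> 0"
    using mult_right_mono[OF y[OF s] h(1)] by (simp add: algebra_simps)
  ultimately show "\<exists>y. ((\<lambda>s. Q r2 p2 s - Q r1 p1 s) has_real_derivative y) (at s) \<and> y \<le> 0" by blast
next
  show "continuous_on {a..c} (\<lambda>s. Q r2 p2 s - Q r1 p1 s)"
    using out fl beta_pos by (intro continuous_intros Q_cont) auto
qed

lemma flow_onD:
  assumes "flow_on r p a c"
  shows "continuous_on {a..c} r" "continuous_on {a..c} p"
    "\<And>s. a \<le> s \<Longrightarrow> s \<le> c \<Longrightarrow> 0 \<le> r s" "\<And>s. a \<le> s \<Longrightarrow> s \<le> c \<Longrightarrow> 0 \<le> p s"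
    "\<And>s. a \<le> s \<Longrightarrow> s \<le> c \<Longrightarrow> 0 < (p s)\<^sup>2 + 2 * F s"
    "\<And>s. a < s \<Longrightarrow> s < c \<Longrightarrow> flow_at r p s"
  using assms by (auto simp: flow_on_def)

lemma flow_atD:
  assumes "flow_at r p s"
  shows "0 < r s" "0 < p s" "(r has_real_derivative - 1 / p s) (at s)"
    "(p has_real_derivative (real n - 1) / r s - f s / p s) (at s)"
  using assms by (auto simp: flow_at_def)

lemma r_decreasing:
  assumes "flow_on r p a c" "a < c"
  shows "r c < r a"
proof (rule DERIV_neg_imp_decreasing_open[OF assms(2)])
  show "continuous_on {a..c} r" using flow_onD[OF assms(1)] by simp
  fix s assume "a < s" "s < c"
  then have "flow_at r p s" using flow_onD[OF assms(1)] by simp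
  then show "\<exists>y. (r has_real_derivative y) (at s) \<and> y < 0"
    using flow_atD by (metis divide_neg_pos neg_less_0_iff_less zero_less_one)
qed

lemma r_pos:
  assumes "flow_on r p a c" "a \<le> s" "s \<le> c" "s < c \<or> 0 < r c"
  shows "0 < r s"
  using r_decreasing[of r p s c] flow_onD(3)[OF assms(1), of c] flow_on_sub[OF assms(1), of s c] assms
  by (cases "s = c") auto

lemma energy_gap_antimono:
  assumes fl: "flow_on r1 p1 a c" "flow_on r2 p2 a c" and "a \<le> c"
    and r: "\<And>s. a < s \<Longrightarrow> s < c \<Longrightarrow> r1 s \<le> r2 s"
  shows "((p2 c)\<^sup>2 - (p1 c)\<^sup>2) * r1 c ^ (n - 1) \<le> ((p2 a)\<^sup>2 - (p1 a)\<^sup>2) * r1 a ^ (n - 1)"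
proof (rule DERIV_nonpos_imp_decreasing_open
    [OF \<open>a \<le> c\<close>, of "\<lambda>s. ((p2 s)\<^sup>2 - (p1 s)\<^sup>2) * r1 s ^ (n - 1)"])
  obtain k where k: "n = Suc (Suc k)" using n_ge by (metis add_2_eq_Suc le_Suc_ex)
  fix s assume s: "a < s" "s < c"
  note f1 = flow_atD[OF flow_onD(6)[OF fl(1) s]] and f2 = flow_atD[OF flow_onD(6)[OF fl(2) s]]
  let ?D = "(2 * p2 s * ((real n - 1) / r2 s - f s / p2 s) - 2 * p1 s * ((real n - 1) / r1 s - f s / p1 s))
     * r1 s ^ Suc k + ((p2 s)\<^sup>2 - (p1 s)\<^sup>2) * (real (Suc k) * r1 s ^ k * (- 1 / p1 s))"
  have "((\<lambda>s. ((p2 s)\<^sup>2 - (p1 s)\<^sup>2) * r1 s ^ (n - 1)) has_real_derivative ?D) (at s)"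
  proof -
    have "((\<lambda>s. (p2 s)\<^sup>2 - (p1 s)\<^sup>2) has_real_derivative
      2 * p2 s * ((real n - 1) / r2 s - f s / p2 s) - 2 * p1 s * ((real n - 1) / r1 s - f s / p1 s)) (at s)"
      by (rule derivative_eq_intros f1(4) f2(4) refl | simp)+
    moreover have "((\<lambda>s. r1 s ^ Suc k) has_real_derivative real (Suc k) * r1 s ^ k * (- 1 / p1 s)) (at s)"
      by (rule derivative_eq_intros f1(3) refl | simp)+
    ultimately show ?thesis unfolding k diff_Suc_1
      by (rule DERIV_mult[THEN DERIV_cong]) (simp add: algebra_simps)
  qed
  moreover have "?D = real (Suc k) * r1 s ^ k * (2 * (p2 s * (r1 s / r2 s) - p1 s) - ((p2 s)\<^sup>2 - (p1 s)\<^sup>2) / p1 s)"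
    using f1(1,2) f2(1,2) by (simp add: k field_simps)
  moreover have "2 * (p2 s * (r1 s / r2 s) - p1 s) - ((p2 s)\<^sup>2 - (p1 s)\<^sup>2) / p1 s \<le> 0"
  proof -
    have "p2 s * (r1 s / r2 s) \<le> p2 s * 1"
      using f1(1) f2(1,2) r[OF s] by (intro mult_left_mono) auto
    then have "2 * (p2 s * (r1 s / r2 s) - p1 s) - ((p2 s)\<^sup>2 - (p1 s)\<^sup>2) / p1 s
        \<le> 2 * (p2 s - p1 s) - ((p2 s)\<^sup>2 - (p1 s)\<^sup>2) / p1 s" by simp
    also have "\<dots> = - ((p2 s - p1 s)\<^sup>2 / p1 s)"
      using f1(2) by (simp add: field_simps power2_eq_square)
    also have "\<dots> \<le> 0" using f1(2) by simp
    finally show ?thesis .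
  qed
  ultimately show "\<exists>y. ((\<lambda>s. ((p2 s)\<^sup>2 - (p1 s)\<^sup>2) * r1 s ^ (n - 1)) has_real_derivative y) (at s) \<and> y \<le> 0"
    using f1(1) by (intro exI[of _ ?D] conjI) (auto intro!: mult_nonneg_nonpos)
next
  show "continuous_on {a..c} (\<lambda>s. ((p2 s)\<^sup>2 - (p1 s)\<^sup>2) * r1 s ^ (n - 1))"
    using flow_onD[OF fl(1)] flow_onD[OF fl(2)] by (intro continuous_intros) auto
qed

lemma faster_persists:
  assumes fl: "flow_on r1 p1 a c" "flow_on r2 p2 a c" and "a \<le> c"
    and r: "\<And>s. a < s \<Longrightarrow> s < c \<Longrightarrow> r1 s \<le> r2 s"
    and "p1 c < p2 c" "0 < r1 c"
  shows "p1 a < p2 a"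
proof -
  have "0 < ((p2 c)\<^sup>2 - (p1 c)\<^sup>2) * r1 c ^ (n - 1)"
    using assms flow_onD(4)[OF fl(1), of c] by (intro mult_pos_pos) (auto simp: power_strict_mono)
  then have "0 < ((p2 a)\<^sup>2 - (p1 a)\<^sup>2) * r1 a ^ (n - 1)"
    using energy_gap_antimono[OF fl \<open>a \<le> c\<close> r] by simp
  moreover have "0 \<le> r1 a ^ (n - 1)" using flow_onD(3)[OF fl(1), of a] \<open>a \<le> c\<close> by simp
  ultimately have "(p1 a)\<^sup>2 < (p2 a)\<^sup>2"
    by (metis diff_gt_0_iff_gt mult_nonpos_nonneg not_less)
  then show ?thesis using flow_onD(4)[OF fl(2), of a] \<open>a \<le> c\<close> by (simp add: power_less_imp_less_base)
qed

lemma overtaken: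
  assumes fl: "flow_on r1 p1 a c" "flow_on r2 p2 a c" and "a < c"
    and y: "\<And>s. a < s \<Longrightarrow> s < c \<Longrightarrow> r1 s * p1 s < r2 s * p2 s"
    and "0 < r1 c" "r2 c \<le> r1 c"
  shows "r2 a < r1 a"
proof -
  have pos: "0 < r1 s" if "a \<le> s" "s \<le> c" for s using r_pos[OF fl(1) that] assms by simp
  have "r2 a / r1 a < r2 c / r1 c"
  proof (rule DERIV_pos_imp_increasing_open[OF \<open>a < c\<close>, of "\<lambda>s. r2 s / r1 s"])
    show "continuous_on {a..c} (\<lambda>s. r2 s / r1 s)"
      using flow_onD[OF fl(1)] flow_onD[OF fl(2)] pos by (intro continuous_intros) force+
    fix s assume s: "a < s" "s < c"
    note f1 = flow_atD[OF flow_onD(6)[OF fl(1) s]] and f2 = flow_atD[OF flow_onD(6)[OF fl(2) s]]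
    have "((\<lambda>s. r2 s / r1 s) has_real_derivative
      (- 1 / p2 s * r1 s - r2 s * (- 1 / p1 s)) / (r1 s * r1 s)) (at s)"
      using f1(1) by (intro DERIV_divide f1(3) f2(3)) auto
    moreover have "(- 1 / p2 s * r1 s - r2 s * (- 1 / p1 s)) = (r2 s * p2 s - r1 s * p1 s) / (p1 s * p2 s)"
      using f1(2) f2(2) by (simp add: field_simps)
    moreover have "0 < (r2 s * p2 s - r1 s * p1 s) / (p1 s * p2 s) / (r1 s * r1 s)"
      using f1(1,2) f2(1,2) y[OF s] by simp
    ultimately show "\<exists>y. ((\<lambda>s. r2 s / r1 s) has_real_derivative y) (at s) \<and> 0 < y" by metis
  qed
  also have "\<dots> \<le> 1" using assms by simp
  finally show ?thesis using pos[of a] \<open>a < c\<close> by simp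
qed

lemma Q_eq:
  "Q r p s = (r s * p s)\<^sup>2 + 2 * ((r s)\<^sup>2 * F s) - 4 * (r s * p s) * (F s / f s) + G s"
  by (simp add: Q_def algebra_simps power_mult_distrib)

lemma ahead_persists_outer:
  assumes fl: "flow_on r1 p1 a c" "flow_on r2 p2 a c" and "a < c" and out: "\<beta> \<le> a \<or> c \<le> - \<beta>"
    and "0 < r1 c" "r2 c \<le> r1 c" "r1 c * p1 c < r2 c * p2 c" "Q r1 p1 c \<le> Q r2 p2 c"
  shows "r2 a < r1 a" "Q r1 p1 a \<le> Q r2 p2 a" "\<bar>a\<bar> \<noteq> \<beta> \<Longrightarrow> r1 a * p1 a < r2 a * p2 a"
proof -
  have y: "r1 s * p1 s < r2 s * p2 s" if s: "a \<le> s" "s \<le> c" "\<bar>s\<bar> \<noteq> \<beta>" for s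
  proof (rule ccontr)
    assume neg: "\<not> ?thesis"
    have "continuous_on {s..c} (\<lambda>s. r2 s * p2 s - r1 s * p1 s)"
      using flow_onD(1,2)[OF fl(1)] flow_onD(1,2)[OF fl(2)] s
      by (intro continuous_intros) (auto intro: continuous_on_subset)
    then obtain e where "s \<le> e" "e < c" "r2 e * p2 e - r1 e * p1 e = 0"
      and e': "\<And>t. e < t \<Longrightarrow> t \<le> c \<Longrightarrow> 0 < r2 t * p2 t - r1 t * p1 t"
      by (rule first_failure) (use s assms(7) neg in auto)
    then have e: "s \<le> e" "e < c" "r1 e * p1 e = r2 e * p2 e"
      "\<And>t. e < t \<Longrightarrow> t \<le> c \<Longrightarrow> r1 t * p1 t < r2 t * p2 t" by force+
    have fle: "flow_on r1 p1 e c" "flow_on r2 p2 e c"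
      using fl e s by (auto intro: flow_on_sub)
    have oute: "\<beta> \<le> e \<or> c \<le> - \<beta>" "\<beta> < \<bar>e\<bar>" using out e s by auto
    have r: "r2 e < r1 e" using overtaken[OF fle] e assms by auto
    have "Q r2 p2 c - Q r1 p1 c \<le> Q r2 p2 e - Q r1 p1 e"
      using e(2) less_imp_le[OF e(4)] by (intro Q_diff_antimono[OF fle _ oute(1)]) auto
    then have "Q r1 p1 e \<le> Q r2 p2 e" using assms by simp
    then have "(r1 e)\<^sup>2 * F e \<le> (r2 e)\<^sup>2 * F e"
      unfolding Q_eq e(3) by linarith
    then have "(r1 e)\<^sup>2 \<le> (r2 e)\<^sup>2" using F_pos[OF oute(2)] by simp
    then show False using r flow_onD(3)[OF fle(2), of e] e(2) by (simp add: power2_le_iff_abs_le)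
  qed
  have y': "r1 s * p1 s < r2 s * p2 s" if "a < s" "s < c" for s
    using y[of s] that out by auto
  show "r2 a < r1 a" by (rule overtaken[OF fl]) (use assms y' in auto)
  have "Q r2 p2 c - Q r1 p1 c \<le> Q r2 p2 a - Q r1 p1 a"
    using less_imp_le[OF y'] \<open>a < c\<close> by (intro Q_diff_antimono[OF fl _ out]) auto
  then show "Q r1 p1 a \<le> Q r2 p2 a" using assms by simp
  show "\<bar>a\<bar> \<noteq> \<beta> \<Longrightarrow> r1 a * p1 a < r2 a * p2 a" using y[of a] \<open>a < c\<close> by simp
qed

lemma W_deriv:
  assumes "flow_at r p s" "0 < (p s)\<^sup>2 + 2 * F s"
  shows "(W r p has_real_derivative ((real n - 2) * (p s)\<^sup>2 - 2 * F s) / (p s * sqrt ((p s)\<^sup>2 + 2 * F s))) (at s)"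
proof -
  note f = flow_atD[OF assms(1)]
  define q where "q = sqrt ((p s)\<^sup>2 + 2 * F s)"
  have q: "q > 0" "q * q = (p s)\<^sup>2 + 2 * F s" using assms(2) by (auto simp: q_def)
  have "((\<lambda>s. (p s)\<^sup>2 + 2 * F s) has_real_derivative 2 * p s * ((real n - 1) / r s - f s / p s) + 2 * f s) (at s)"
    by (rule derivative_eq_intros f(4) F_deriv refl | simp)+
  then have "((\<lambda>s. sqrt ((p s)\<^sup>2 + 2 * F s)) has_real_derivative
      (2 * p s * ((real n - 1) / r s - f s / p s) + 2 * f s) * (inverse q / 2)) (at s)"
    unfolding q_def
    by (rule DERIV_chain2[where f = sqrt and g = "\<lambda>s. (p s)\<^sup>2 + 2 * F s",
          OF DERIV_real_sqrt[OF assms(2)], THEN DERIV_cong]) simp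
  from DERIV_mult'[OF f(3) this]
  have "((\<lambda>s. r s * sqrt ((p s)\<^sup>2 + 2 * F s)) has_real_derivative
     r s * ((2 * p s * ((real n - 1) / r s - f s / p s) + 2 * f s) * (inverse q / 2)) + - 1 / p s * q) (at s)"
    by (simp add: q_def)
  moreover have "r s * ((2 * p s * ((real n - 1) / r s - f s / p s) + 2 * f s) * (inverse q / 2)) + - 1 / p s * q
     = ((real n - 1) * (p s)\<^sup>2 - q * q) / (p s * q)"
    using f(1,2) q(1) by (simp add: field_simps power2_eq_square)
  ultimately show ?thesis unfolding q(2) W_def[abs_def] q_def[symmetric] by (simp add: algebra_simps)
qed

lemma W_rate_antimono:
  assumes p: "0 < p" "p \<le> p'" and F: "F s \<le> 0" and I: "0 < p\<^sup>2 + 2 * F s"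
  defines "rate \<equiv> \<lambda>x. ((real n - 2) * x\<^sup>2 - 2 * F s) / (x * sqrt (x\<^sup>2 + 2 * F s))"
  shows "rate p' \<le> rate p" and "p < p' \<Longrightarrow> F s < 0 \<Longrightarrow> rate p' < rate p"
proof -
  define c where "c = - 2 * F s"
  have c: "0 \<le> c" "0 < p\<^sup>2 - c" using F I by (auto simp: c_def)
  have pp: "p\<^sup>2 \<le> p'\<^sup>2" using p by (simp add: power_mono)
  have c': "0 < p'\<^sup>2 - c" using c pp by linarith
  have eq: "rate x
     = (real n - 2) * (x / sqrt (x\<^sup>2 - c)) + c / (x * sqrt (x\<^sup>2 - c))" if "0 < x" "0 < x\<^sup>2 - c" for x
  proof -
    have "((real n - 2) * x\<^sup>2 + c) / (x * q) = (real n - 2) * (x / q) + c / (x * q)" if "q > 0" for q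
      using that \<open>0 < x\<close> by (simp add: field_simps power2_eq_square)
    from this[of "sqrt (x\<^sup>2 - c)"] that show ?thesis by (simp add: c_def rate_def)
  qed
  have "p' / sqrt (p'\<^sup>2 - c) \<le> p / sqrt (p\<^sup>2 - c)"
  proof -
    have "p'\<^sup>2 / (p'\<^sup>2 - c) \<le> p\<^sup>2 / (p\<^sup>2 - c)"
      using c pp mult_left_mono[OF pp c(1)] by (simp add: field_simps)
    then have "sqrt (p'\<^sup>2 / (p'\<^sup>2 - c)) \<le> sqrt (p\<^sup>2 / (p\<^sup>2 - c))" by simp
    then show ?thesis using p by (simp add: real_sqrt_divide)
  qed
  then have R1: "(real n - 2) * (p' / sqrt (p'\<^sup>2 - c)) \<le> (real n - 2) * (p / sqrt (p\<^sup>2 - c))"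
    using n_ge by (intro mult_left_mono) auto
  have sq: "0 < sqrt (p\<^sup>2 - c)" "0 < sqrt (p'\<^sup>2 - c)" "sqrt (p\<^sup>2 - c) \<le> sqrt (p'\<^sup>2 - c)"
    using c c' pp by simp_all
  have R2: "c / (p' * sqrt (p'\<^sup>2 - c)) \<le> c / (p * sqrt (p\<^sup>2 - c))"
    using sq p c by (intro divide_left_mono mult_mono mult_pos_pos) auto
  show "rate p' \<le> rate p" using p c c' eq[of p] eq[of p'] R1 R2 by linarith
  assume "p < p'" "F s < 0"
  then have "c / (p' * sqrt (p'\<^sup>2 - c)) < c / (p * sqrt (p\<^sup>2 - c))"
    using sq p by (intro divide_strict_left_mono mult_less_le_imp_less mult_pos_pos) (auto simp: c_def)
  then show "rate p' < rate p" using p c c' eq[of p] eq[of p'] R1 by linarith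
qed

lemma W_cont: "flow_on r p a c \<Longrightarrow> continuous_on {a..c} (W r p)"
  unfolding W_def[abs_def] by (intro continuous_intros F_cont flow_onD)

lemma ahead_persists_inner:
  assumes fl: "flow_on r1 p1 a c" "flow_on r2 p2 a c" and "a < c" and inn: "- \<beta> \<le> a" "c \<le> \<beta>"
    and "0 < r1 c" "r2 c \<le> r1 c" "p1 c < p2 c" "W r1 p1 c \<le> W r2 p2 c"
  shows "r2 a < r1 a" "p1 a < p2 a" "W r2 p2 c - W r1 p1 c \<le> W r2 p2 a - W r1 p1 a"
proof -
  have from_faster: "r2 e < r1 e \<and> W r2 p2 c - W r1 p1 c \<le> W r2 p2 e - W r1 p1 e"
    if e: "a \<le> e" "e < c" and p: "\<And>s. e < s \<Longrightarrow> s < c \<Longrightarrow> p1 s < p2 s" for e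
  proof
    have fle: "flow_on r1 p1 e c" "flow_on r2 p2 e c" using fl e by (auto intro: flow_on_sub)
    have "r2 e - r1 e < r2 c - r1 c"
    proof (rule DERIV_pos_imp_increasing_open[OF \<open>e < c\<close>, of "\<lambda>s. r2 s - r1 s"])
      show "continuous_on {e..c} (\<lambda>s. r2 s - r1 s)"
        using flow_onD[OF fle(1)] flow_onD[OF fle(2)] by (intro continuous_intros) auto
      fix s assume s: "e < s" "s < c"
      note f1 = flow_atD[OF flow_onD(6)[OF fle(1) s]] and f2 = flow_atD[OF flow_onD(6)[OF fle(2) s]]
      show "\<exists>y. ((\<lambda>s. r2 s - r1 s) has_real_derivative y) (at s) \<and> 0 < y"
        using p[OF s] f1(2) f2(2)
        by (intro exI[of _ "- 1 / p2 s - - 1 / p1 s"] conjI DERIV_diff f1(3) f2(3)) (auto simp: field_simps)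
    qed
    then show "r2 e < r1 e" using assms by simp
    show "W r2 p2 c - W r1 p1 c \<le> W r2 p2 e - W r1 p1 e"
    proof (rule DERIV_nonpos_imp_decreasing_open[of e c "\<lambda>s. W r2 p2 s - W r1 p1 s"])
      show "e \<le> c" using e by simp
      show "continuous_on {e..c} (\<lambda>s. W r2 p2 s - W r1 p1 s)"
        using W_cont fle by (intro continuous_intros) auto
      fix s assume s: "e < s" "s < c"
      have I: "0 < (p1 s)\<^sup>2 + 2 * F s" "0 < (p2 s)\<^sup>2 + 2 * F s"
        using flow_onD(5)[OF fle(1)] flow_onD(5)[OF fle(2)] s by auto
      have "F s \<le> 0" using F_nonpos[of s] s e inn by auto
      from W_rate_antimono(1)[OF _ _ this I(1), of "p2 s"] p[OF s]
        flow_atD(2)[OF flow_onD(6)[OF fle(1) s]]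
      show "\<exists>y. ((\<lambda>s. W r2 p2 s - W r1 p1 s) has_real_derivative y) (at s) \<and> y \<le> 0"
        using DERIV_diff[OF W_deriv[OF flow_onD(6)[OF fle(2) s] I(2)] W_deriv[OF flow_onD(6)[OF fle(1) s] I(1)]]
        by fastforce
    qed
  qed
  have p: "p1 s < p2 s" if s: "a \<le> s" "s \<le> c" for s
  proof (rule ccontr)
    assume neg: "\<not> ?thesis"
    have "continuous_on {s..c} (\<lambda>s. p2 s - p1 s)"
      using flow_onD(1,2)[OF fl(1)] flow_onD(1,2)[OF fl(2)] s
      by (intro continuous_intros) (auto intro: continuous_on_subset)
    then obtain e where "s \<le> e" "e < c" "p2 e - p1 e = 0"
      and "\<And>t. e < t \<Longrightarrow> t \<le> c \<Longrightarrow> 0 < p2 t - p1 t"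
      by (rule first_failure) (use s assms(8) neg in auto)
    then have e: "s \<le> e" "e < c" "p1 e = p2 e" "\<And>t. e < t \<Longrightarrow> t \<le> c \<Longrightarrow> p1 t < p2 t" by force+
    then have "r2 e < r1 e" "W r1 p1 e \<le> W r2 p2 e" using from_faster[of e] s assms by auto
    moreover have "0 < sqrt ((p2 e)\<^sup>2 + 2 * F e)" using flow_onD(5)[OF fl(2), of e] e s by simp
    ultimately show False using e(3) by (simp add: W_def)
  qed
  show "r2 a < r1 a" "W r2 p2 c - W r1 p1 c \<le> W r2 p2 a - W r1 p1 a"
    using from_faster[of a] p \<open>a < c\<close> by auto
  show "p1 a < p2 a" using p \<open>a < c\<close> by simp
qed

section \<open>Comparison along one descent\<close>

lemma F_neg:
  assumes "b < s" "s < \<beta>" shows "F s < 0"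
proof -
  have "F s < F \<beta>"
    by (rule DERIV_pos_imp_increasing_open[OF \<open>s < \<beta>\<close> _ F_cont])
      (use F_deriv f_pos assms in force)
  then show ?thesis by (simp add: F_beta)
qed

lemma crossing:
  assumes fl: "flow_on r1 p1 a c" "flow_on r2 p2 a c" and "a \<le> c"
    and "0 < r1 c" "r1 c < r2 c" "p1 c < p2 c"
  obtains "\<And>s. a \<le> s \<Longrightarrow> s \<le> c \<Longrightarrow> r1 s < r2 s \<and> p1 s < p2 s"
  | e where "a \<le> e" "e < c" "r2 e = r1 e" "p1 e < p2 e"
    "\<And>s. e < s \<Longrightarrow> s \<le> c \<Longrightarrow> r1 s < r2 s \<and> p1 s < p2 s"
proof -
  have p: "p1 s < p2 s" if "a \<le> s" "s \<le> c" "\<And>t. s < t \<Longrightarrow> t < c \<Longrightarrow> r1 t \<le> r2 t" for s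
    by (rule faster_persists[of _ _ s c]) (use that assms in \<open>auto intro: flow_on_sub\<close>)
  show ?thesis
  proof (cases "\<exists>s. a \<le> s \<and> s \<le> c \<and> \<not> r1 s < r2 s")
    case False
    then show ?thesis using p that(1) by (metis less_imp_le order_trans)
  next
    case True
    then obtain s where s: "a \<le> s" "s \<le> c" "\<not> r1 s < r2 s" by blast
    have "continuous_on {s..c} (\<lambda>s. r2 s - r1 s)"
      using flow_onD(1)[OF fl(1)] flow_onD(1)[OF fl(2)] s
      by (intro continuous_intros) (auto intro: continuous_on_subset)
    then obtain e where e: "s \<le> e" "e < c" "r2 e - r1 e = 0"
      "\<And>t. e < t \<Longrightarrow> t \<le> c \<Longrightarrow> 0 < r2 t - r1 t"
      by (rule first_failure) (use s assms in auto)
    have r: "r1 t < r2 t" if "e < t" "t \<le> c" for t using e(4)[OF that] by simp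
    have "p1 t < p2 t" if "e \<le> t" "t \<le> c" for t
      using p[of t] r that e s by (meson less_imp_le order_trans le_less_trans)
    then show ?thesis using that(2)[of e] e s r by auto
  qed
qed

lemma p_pos_inner:
  assumes "flow_on r p a c" "a \<le> s" "s \<le> c" "\<bar>s\<bar> \<le> \<beta>"
  shows "0 < p s"
  using flow_onD(4,5)[OF assms(1-3)] F_nonpos[OF assms(4)]
  by (cases "p s = 0") auto

lemma W_beta:
  assumes "flow_on r p a c" "a \<le> s" "s \<le> c" "\<bar>s\<bar> = \<beta>"
  shows "W r p s = r s * p s" "Q r p s = (r s * p s)\<^sup>2"
proof -
  have "F s = 0" using F_beta F_abs[of s] assms by simp
  then show "W r p s = r s * p s" "Q r p s = (r s * p s)\<^sup>2"
    using flow_onD(4)[OF assms(1-3)] G_beta[OF assms(4)] by (auto simp: W_def Q_eq)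
qed

lemma W_less:
  assumes "r2 s = r1 s" "0 < r1 s" "p1 s < p2 s" "0 \<le> p1 s"
  shows "W r1 p1 s < W r2 p2 s"
  using assms by (simp add: W_def power_strict_mono)

definition leads :: "(real \<Rightarrow> real) \<Rightarrow> (real \<Rightarrow> real) \<Rightarrow> (real \<Rightarrow> real) \<Rightarrow> (real \<Rightarrow> real) \<Rightarrow> real \<Rightarrow> bool" where
  "leads r1 p1 r2 p2 s \<longleftrightarrow> p1 s < p2 s \<and> (r1 s < r2 s \<or> r2 s \<le> r1 s \<and> W r1 p1 s < W r2 p2 s)"

definition above_leads :: "(real \<Rightarrow> real) \<Rightarrow> (real \<Rightarrow> real) \<Rightarrow> (real \<Rightarrow> real) \<Rightarrow> (real \<Rightarrow> real) \<Rightarrow> real \<Rightarrow> bool" where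
  "above_leads r1 p1 r2 p2 s \<longleftrightarrow> p1 s < p2 s \<and> r1 s * p1 s < r2 s * p2 s \<and> Q r1 p1 s \<le> Q r2 p2 s"

lemma upper_phase:
  assumes fl: "flow_on r1 p1 \<beta> c" "flow_on r2 p2 \<beta> c" and "\<beta> < c" and r1c: "0 < r1 c"
    and st: "above_leads r1 p1 r2 p2 c"
  shows "p1 \<beta> < p2 \<beta> \<and> (r1 \<beta> < r2 \<beta> \<or> r2 \<beta> \<le> r1 \<beta> \<and> W r1 p1 \<beta> \<le> W r2 p2 \<beta>)"
proof -
  have pos: "0 < r1 s" "0 < r2 s" if "\<beta> \<le> s" "s < c" for s
    using r_pos[OF fl(1)] r_pos[OF fl(2)] that by auto
  have pb: "0 < p1 \<beta>" "0 < p2 \<beta>"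
    using p_pos_inner[OF fl(1), of \<beta>] p_pos_inner[OF fl(2), of \<beta>] \<open>\<beta> < c\<close> beta_pos by auto
  have Wb: "W r1 p1 \<beta> = r1 \<beta> * p1 \<beta>" "W r2 p2 \<beta> = r2 \<beta> * p2 \<beta>"
    "Q r1 p1 \<beta> = (r1 \<beta> * p1 \<beta>)\<^sup>2" "Q r2 p2 \<beta> = (r2 \<beta> * p2 \<beta>)\<^sup>2"
    using W_beta[OF fl(1), of \<beta>] W_beta[OF fl(2), of \<beta>] \<open>\<beta> < c\<close> beta_pos by auto
  have main: ?thesis
    if e: "\<beta> < e" "e \<le> c" "r2 e \<le> r1 e" "r1 e * p1 e < r2 e * p2 e" "Q r1 p1 e \<le> Q r2 p2 e" for e
  proof -
    have fle: "flow_on r1 p1 \<beta> e" "flow_on r2 p2 \<beta> e" using fl e by (auto intro: flow_on_sub)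
    have "0 < r1 e" using pos[of e] r1c e by (cases "e = c") auto
    from ahead_persists_outer[OF fle e(1) _ this e(3-5)]
    have r: "r2 \<beta> < r1 \<beta>" and Q: "Q r1 p1 \<beta> \<le> Q r2 p2 \<beta>" by simp_all
    have r2: "0 < r2 \<beta>" using pos(2)[of \<beta>] \<open>\<beta> < c\<close> by simp
    have "0 \<le> r2 \<beta> * p2 \<beta>" using r2 pb by simp
    then have y: "r1 \<beta> * p1 \<beta> \<le> r2 \<beta> * p2 \<beta>" using Q unfolding Wb by (rule power2_le_imp_le[rotated])
    have "r2 \<beta> * p1 \<beta> < r1 \<beta> * p1 \<beta>" using r pb by simp
    also note y
    finally have "p1 \<beta> < p2 \<beta>" using r2 by simp
    then show ?thesis using r y unfolding Wb by simp
  qed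
  show ?thesis
  proof (cases "r2 c \<le> r1 c")
    case True
    then show ?thesis using main[of c] st \<open>\<beta> < c\<close> by (auto simp: above_leads_def)
  next
    case False
    then have r: "r1 c < r2 c" "p1 c < p2 c" using st by (auto simp: above_leads_def)
    show ?thesis
    proof (rule crossing[OF fl less_imp_le[OF \<open>\<beta> < c\<close>] r1c r])
      assume "\<And>s. \<beta> \<le> s \<Longrightarrow> s \<le> c \<Longrightarrow> r1 s < r2 s \<and> p1 s < p2 s"
      then show ?thesis using \<open>\<beta> < c\<close> by auto
    next
      fix e assume e: "\<beta> \<le> e" "e < c" "r2 e = r1 e" "p1 e < p2 e"
        and after: "\<And>s. e < s \<Longrightarrow> s \<le> c \<Longrightarrow> r1 s < r2 s \<and> p1 s < p2 s"
      show ?thesis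
      proof (cases "e = \<beta>")
        case True
        then show ?thesis using e pos[of \<beta>] unfolding Wb by auto
      next
        case False
        have fle: "flow_on r1 p1 e c" "flow_on r2 p2 e c" using fl e by (auto intro: flow_on_sub)
        have "Q r2 p2 c - Q r1 p1 c \<le> Q r2 p2 e - Q r1 p1 e"
        proof (rule Q_diff_antimono[OF fle])
          fix s assume "e < s" "s < c"
          then show "r1 s * p1 s \<le> r2 s * p2 s"
            using after[of s] flow_onD(3,4)[OF fle(1), of s] by (intro mult_mono) auto
        qed (use e in auto)
        then show ?thesis using main[of e] e False pos[of e] st by (auto simp: above_leads_def)
      qed
    qed
  qed
qed

lemma W_gap_strict:
  assumes fl: "flow_on r1 p1 a c" "flow_on r2 p2 a c" and "a < c"
    and p: "\<And>s. a < s \<Longrightarrow> s < c \<Longrightarrow> p1 s < p2 s" and neg: "\<And>s. a < s \<Longrightarrow> s < c \<Longrightarrow> F s < 0"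
  shows "W r2 p2 c - W r1 p1 c < W r2 p2 a - W r1 p1 a"
proof (rule DERIV_neg_imp_decreasing_open[OF \<open>a < c\<close>, of "\<lambda>s. W r2 p2 s - W r1 p1 s"])
  show "continuous_on {a..c} (\<lambda>s. W r2 p2 s - W r1 p1 s)"
    using W_cont fl by (intro continuous_intros) auto
  fix s assume s: "a < s" "s < c"
  have I: "0 < (p1 s)\<^sup>2 + 2 * F s" "0 < (p2 s)\<^sup>2 + 2 * F s"
    using flow_onD(5)[OF fl(1)] flow_onD(5)[OF fl(2)] s by auto
  from W_rate_antimono(2)[OF _ less_imp_le[OF p[OF s]] less_imp_le[OF neg[OF s]] I(1) p[OF s] neg[OF s]] flow_atD(2)[OF flow_onD(6)[OF fl(1) s]]
  show "\<exists>y. ((\<lambda>s. W r2 p2 s - W r1 p1 s) has_real_derivative y) (at s) \<and> y < 0"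
    using DERIV_diff[OF W_deriv[OF flow_onD(6)[OF fl(2) s] I(2)] W_deriv[OF flow_onD(6)[OF fl(1) s] I(1)]]
    by fastforce
qed

lemma inner_phase:
  assumes fl: "flow_on r1 p1 a c" "flow_on r2 p2 a c" and "a < c" and inn: "- \<beta> \<le> a" "c \<le> \<beta>"
    and r1c: "0 < r1 c" and p: "p1 c < p2 c"
    and st: "r1 c < r2 c \<or> r2 c \<le> r1 c \<and> W r1 p1 c < W r2 p2 c \<or>
      r2 c \<le> r1 c \<and> W r1 p1 c \<le> W r2 p2 c \<and> (\<forall>s. a < s \<longrightarrow> s < c \<longrightarrow> F s < 0)"
  shows "leads r1 p1 r2 p2 a"
proof (cases "r1 c < r2 c")
  case True
  show ?thesis
  proof (rule crossing[OF fl less_imp_le[OF \<open>a < c\<close>] r1c True p])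
    assume "\<And>s. a \<le> s \<Longrightarrow> s \<le> c \<Longrightarrow> r1 s < r2 s \<and> p1 s < p2 s"
    then show ?thesis using \<open>a < c\<close> by (auto simp: leads_def)
  next
    fix e assume e: "a \<le> e" "e < c" "r2 e = r1 e" "p1 e < p2 e"
    have r1e: "0 < r1 e" using r_pos[OF fl(1), of e] e by auto
    have We: "W r1 p1 e < W r2 p2 e"
      using e r1e flow_onD(4)[OF fl(1), of e] by (intro W_less) auto
    show ?thesis
    proof (cases "e = a")
      case True then show ?thesis using e We by (auto simp: leads_def)
    next
      case False
      then have "a < e" using e by simp
      have "flow_on r1 p1 a e" "flow_on r2 p2 a e" using fl e by (auto intro: flow_on_sub)
      from ahead_persists_inner[OF this \<open>a < e\<close> inn(1) _ r1e _ e(4)] e We inn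
      show ?thesis by (auto simp: leads_def)
    qed
  qed
next
  case False
  then have st': "r2 c \<le> r1 c" "W r1 p1 c \<le> W r2 p2 c" using st by auto
  note * = ahead_persists_inner[OF fl \<open>a < c\<close> inn r1c st'(1) p st'(2)]
  have "W r1 p1 a < W r2 p2 a"
  proof (cases "W r1 p1 c < W r2 p2 c")
    case True then show ?thesis using * by simp
  next
    case False
    then have neg: "F s < 0" if "a < s" "s < c" for s using st st' that by auto
    have "p1 s < p2 s" if s: "a < s" "s < c" for s
    proof -
      have "flow_on r1 p1 s c" "flow_on r2 p2 s c" using fl s by (auto intro: flow_on_sub)
      from ahead_persists_inner[OF this s(2) _ inn(2) r1c st'(1) p st'(2)] show ?thesis
        using inn s by simp
    qed
    from W_gap_strict[OF fl \<open>a < c\<close> this neg] st' show ?thesis by simp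
  qed
  then show ?thesis using * by (auto simp: leads_def)
qed

lemma Q_less_outer:
  assumes "a \<le> - \<beta>" "0 \<le> r1 a" "0 \<le> p1 a" "r1 a \<le> r2 a" "p1 a \<le> p2 a"
  shows "Q r1 p1 a \<le> Q r2 p2 a"
proof -
  have F: "0 \<le> F a" using F_pos[of a] F_beta F_abs[of a] assms beta_pos by (cases "a = - \<beta>") auto
  have "f a < 0" using f_pos[of "- a"] f_odd[of a] assms b_less by simp
  then have q: "0 \<le> - (F a / f a)" using F by (simp add: divide_nonneg_neg)
  have y: "r1 a * p1 a \<le> r2 a * p2 a" using assms by (intro mult_mono) auto
  have "(r1 a * p1 a)\<^sup>2 \<le> (r2 a * p2 a)\<^sup>2" using y assms by (intro power_mono) auto
  moreover have "(r1 a)\<^sup>2 * F a \<le> (r2 a)\<^sup>2 * F a" using F assms by (intro mult_right_mono power_mono) auto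
  moreover have "4 * (r1 a * p1 a) * - (F a / f a) \<le> 4 * (r2 a * p2 a) * - (F a / f a)"
    using y q by (intro mult_right_mono) auto
  ultimately show ?thesis unfolding Q_eq by linarith
qed

lemma lower_phase:
  assumes fl: "flow_on r1 p1 a (- \<beta>)" "flow_on r2 p2 a (- \<beta>)" and "a < - \<beta>"
    and r1b: "0 < r1 (- \<beta>)" and st: "leads r1 p1 r2 p2 (- \<beta>)"
  shows "r1 a * p1 a < r2 a * p2 a \<and> Q r1 p1 a \<le> Q r2 p2 a"
proof -
  have main: ?thesis
    if e: "a < e" "e \<le> - \<beta>" "r2 e \<le> r1 e" "r1 e * p1 e < r2 e * p2 e" "Q r1 p1 e \<le> Q r2 p2 e" for e
  proof -
    have fle: "flow_on r1 p1 a e" "flow_on r2 p2 a e" using fl e by (auto intro: flow_on_sub)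
    have "0 < r1 e" using r_pos[OF fl(1), of e] r1b e by auto
    from ahead_persists_outer[OF fle e(1) _ this e(3-5)] e(1,2)
    show ?thesis by auto
  qed
  show ?thesis
  proof (cases "r1 (- \<beta>) < r2 (- \<beta>)")
    case True
    have p: "p1 (- \<beta>) < p2 (- \<beta>)" using st by (simp add: leads_def)
    show ?thesis
    proof (rule crossing[OF fl less_imp_le[OF \<open>a < - \<beta>\<close>] r1b True p])
      assume *: "\<And>s. a \<le> s \<Longrightarrow> s \<le> - \<beta> \<Longrightarrow> r1 s < r2 s \<and> p1 s < p2 s"
      have "0 < r1 a" "0 \<le> p1 a" "r1 a < r2 a" "p1 a < p2 a"
        using *[of a] \<open>a < - \<beta>\<close> r_pos[OF fl(1), of a] flow_onD(4)[OF fl(1), of a] by auto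
      then show ?thesis using Q_less_outer[of a r1 p1 r2 p2] \<open>a < - \<beta>\<close>
        by (auto intro: mult_strict_mono)
    next
      fix e assume e: "a \<le> e" "e < - \<beta>" "r2 e = r1 e" "p1 e < p2 e"
      have pos: "0 < r1 e" "0 \<le> p1 e"
        using r_pos[OF fl(1), of e] flow_onD(4)[OF fl(1), of e] e by auto
      have "r1 e * p1 e < r2 e * p2 e" "Q r1 p1 e \<le> Q r2 p2 e"
        using e pos by (auto intro!: Q_less_outer)
      then show ?thesis using main[of e] e by (cases "e = a") auto
    qed
  next
    case False
    then have "r2 (- \<beta>) \<le> r1 (- \<beta>)" "r1 (- \<beta>) * p1 (- \<beta>) < r2 (- \<beta>) * p2 (- \<beta>)"
      using st W_beta(1)[OF fl(1), of "- \<beta>"] W_beta(1)[OF fl(2), of "- \<beta>"] \<open>a < - \<beta>\<close> beta_pos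
      by (auto simp: leads_def)
    moreover from this have "Q r1 p1 (- \<beta>) \<le> Q r2 p2 (- \<beta>)"
      using W_beta(2)[OF fl(1), of "- \<beta>"] W_beta(2)[OF fl(2), of "- \<beta>"] \<open>a < - \<beta>\<close> beta_pos
        flow_onD(3,4)[OF fl(1), of "- \<beta>"] by (simp add: power_mono)
    ultimately show ?thesis using main[of "- \<beta>"] \<open>a < - \<beta>\<close> by auto
  qed
qed

lemma leads_at_b:
  assumes fl: "flow_on r1 p1 b c" "flow_on r2 p2 b c" and "\<beta> < c" and r1c: "0 < r1 c"
    and st: "above_leads r1 p1 r2 p2 c"
  shows "leads r1 p1 r2 p2 b"
proof -
  have "p1 \<beta> < p2 \<beta> \<and> (r1 \<beta> < r2 \<beta> \<or> r2 \<beta> \<le> r1 \<beta> \<and> W r1 p1 \<beta> \<le> W r2 p2 \<beta>)"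
    using b_less fl by (intro upper_phase[OF _ _ \<open>\<beta> < c\<close> r1c st]) (auto intro: flow_on_sub)
  moreover have "flow_on r1 p1 b \<beta>" "flow_on r2 p2 b \<beta>" using fl \<open>\<beta> < c\<close> by (auto intro: flow_on_sub)
  moreover have "0 < r1 \<beta>" using r_pos[OF fl(1), of \<beta>] b_less \<open>\<beta> < c\<close> by simp
  ultimately show ?thesis
    using b_less b_pos F_neg by (intro inner_phase[of _ _ b \<beta>]) auto
qed

lemma full_descent:
  assumes fl: "flow_on r1 p1 a c" "flow_on r2 p2 a c" and "a < - \<beta>" "\<beta> < c" and r1c: "0 < r1 c"
    and st: "above_leads r1 p1 r2 p2 c"
  shows "r1 a * p1 a < r2 a * p2 a \<and> Q r1 p1 a \<le> Q r2 p2 a"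
proof -
  have pos: "0 < r1 s" if "a \<le> s" "s \<le> c" for s using r_pos[OF fl(1) that] r1c by simp
  have "leads r1 p1 r2 p2 b"
    using fl b_less b_pos assms by (intro leads_at_b[OF _ _ \<open>\<beta> < c\<close> r1c st]) (auto intro: flow_on_sub)
  then have "leads r1 p1 r2 p2 (- \<beta>)"
    using fl b_less b_pos assms pos[of b]
    by (intro inner_phase[of _ _ "- \<beta>" b]) (auto simp: leads_def intro: flow_on_sub)
  then show ?thesis
    using fl b_less b_pos assms pos[of "- \<beta>"] by (intro lower_phase) (auto intro: flow_on_sub)
qed

lemma energy_decay:
  assumes fl: "flow_on r p a \<beta>" "- \<beta> \<le> a" "a \<le> \<beta>"
  shows "((p a)\<^sup>2 + 2 * F a) * (r a ^ (n - 1))\<^sup>2 \<le> ((p \<beta>)\<^sup>2 + 2 * F \<beta>) * (r \<beta> ^ (n - 1))\<^sup>2"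
proof (rule DERIV_nonneg_imp_increasing_open
    [OF \<open>a \<le> \<beta>\<close>, of "\<lambda>s. ((p s)\<^sup>2 + 2 * F s) * (r s ^ (n - 1))\<^sup>2"])
  obtain k where k: "n = Suc (Suc k)" using n_ge by (metis add_2_eq_Suc le_Suc_ex)
  show "continuous_on {a..\<beta>} (\<lambda>s. ((p s)\<^sup>2 + 2 * F s) * (r s ^ (n - 1))\<^sup>2)"
    by (intro continuous_intros flow_onD[OF fl(1)] F_cont)
  fix s assume s: "a < s" "s < \<beta>"
  note f1 = flow_atD[OF flow_onD(6)[OF fl(1) s]]
  have d1: "((\<lambda>s. (p s)\<^sup>2 + 2 * F s) has_real_derivative 2 * p s * ((real n - 1) / r s - f s / p s) + 2 * f s) (at s)"
    by (rule derivative_eq_intros f1(4) F_deriv refl | simp)+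
  have d2: "((\<lambda>s. r s ^ (2 * Suc k)) has_real_derivative
      real (2 * Suc k) * r s ^ (2 * k + 1) * (- 1 / p s)) (at s)"
    by (rule derivative_eq_intros f1(3) refl | simp)+
  have eq: "(\<lambda>s. ((p s)\<^sup>2 + 2 * F s) * (r s ^ (n - 1))\<^sup>2) = (\<lambda>s. ((p s)\<^sup>2 + 2 * F s) * r s ^ (2 * Suc k))"
    by (simp only: k diff_Suc_1 power_even_eq)
  have D: "((\<lambda>s. ((p s)\<^sup>2 + 2 * F s) * (r s ^ (n - 1))\<^sup>2) has_real_derivative
    (2 * p s * ((real n - 1) / r s - f s / p s) + 2 * f s) * r s ^ (2 * Suc k) +
      (real (2 * Suc k) * r s ^ (2 * k + 1) * (- 1 / p s)) * ((p s)\<^sup>2 + 2 * F s)) (at s)"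
    unfolding eq by (rule DERIV_mult[OF d1 d2])
  have Deq: "(2 * p s * ((real n - 1) / r s - f s / p s) + 2 * f s) * r s ^ (2 * Suc k) +
      (real (2 * Suc k) * r s ^ (2 * k + 1) * (- 1 / p s)) * ((p s)\<^sup>2 + 2 * F s)
      = real (2 * Suc k) * r s ^ (2 * k + 1) / p s * (- 2 * F s)"
    using f1(1,2) by (simp add: k field_simps power2_eq_square)
  have "0 \<le> real (2 * Suc k) * r s ^ (2 * k + 1) / p s * (- 2 * F s)"
  proof (rule mult_nonneg_nonneg)
    show "0 \<le> - 2 * F s" using F_nonpos[of s] s fl(2) by simp
    show "0 \<le> real (2 * Suc k) * r s ^ (2 * k + 1) / p s"
      using f1(1,2) by (intro divide_nonneg_pos mult_nonneg_nonneg zero_le_power) auto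
  qed
  with D[unfolded Deq] show "\<exists>y. ((\<lambda>s. ((p s)\<^sup>2 + 2 * F s) * (r s ^ (n - 1))\<^sup>2) has_real_derivative y) (at s) \<and> 0 \<le> y"
    by blast
qed

lemma final_descent_False:
  assumes fl: "\<And>a. 0 < a \<Longrightarrow> flow_on r1 p1 a c" "\<And>a. 0 < a \<Longrightarrow> flow_on r2 p2 a c"
    and "\<beta> < c" and r1c: "0 < r1 c" and st: "above_leads r1 p1 r2 p2 c"
    and lim: "\<And>\<epsilon>. 0 < \<epsilon> \<Longrightarrow> \<exists>s0>0. \<forall>s. 0 < s \<longrightarrow> s < s0 \<longrightarrow> (p2 s)\<^sup>2 + 2 * F s < \<epsilon>"
  shows False
proof -
  have pos: "0 < r1 s" "0 < r2 s" if "0 < s" "s < c" for s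
    using r_pos[OF fl(1), of s s] r_pos[OF fl(2), of s s] that by auto
  have lb: "leads r1 p1 r2 p2 b" by (rule leads_at_b[OF fl(1,2) \<open>\<beta> < c\<close> r1c st]) (use b_pos in auto)
  have leads: "leads r1 p1 r2 p2 s" if s: "0 < s" "s < b" for s
    using fl(1,2)[OF s(1)] s b_less lb pos[of b] b_pos \<open>\<beta> < c\<close>
    by (intro inner_phase[of _ _ s b]) (auto simp: leads_def intro: flow_on_sub)
  show False
  proof (cases "\<forall>s. 0 < s \<longrightarrow> s \<le> b \<longrightarrow> r1 s < r2 s")
    case True
    define C where "C = ((p2 \<beta>)\<^sup>2 + 2 * F \<beta>) * (r2 \<beta> ^ (n - 1))\<^sup>2"
    define d where "d = ((p2 b)\<^sup>2 - (p1 b)\<^sup>2) * r1 b ^ (n - 1)"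
    have "0 < C" unfolding C_def
      using flow_onD(5)[OF fl(2)[OF beta_pos], of \<beta>] pos[of \<beta>] beta_pos \<open>\<beta> < c\<close>
      by (intro mult_pos_pos) auto
    have "0 < d" unfolding d_def
      using lb pos[of b] b_pos b_less \<open>\<beta> < c\<close> flow_onD(4)[OF fl(1)[OF b_pos], of b]
      by (intro mult_pos_pos) (auto simp: leads_def power_strict_mono)
    obtain s0 where s0: "0 < s0" "\<And>s. 0 < s \<Longrightarrow> s < s0 \<Longrightarrow> (p2 s)\<^sup>2 + 2 * F s < d\<^sup>2 / C"
      using lim[of "d\<^sup>2 / C"] \<open>0 < C\<close> \<open>0 < d\<close> by auto
    define s where "s = min s0 b / 2"
    have s: "0 < s" "s < s0" "s < b" using s0 b_pos by (auto simp: s_def)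
    have fs: "flow_on r1 p1 s b" "flow_on r2 p2 s b" "flow_on r2 p2 s \<beta>"
      using fl(1,2)[OF s(1)] b_less \<open>\<beta> < c\<close> by (auto intro: flow_on_sub)
    define K where "K = (p2 s)\<^sup>2 + 2 * F s"
    have Kpos: "0 < K" using flow_onD(5)[OF fs(2)] s by (simp add: K_def)
    have "d \<le> ((p2 s)\<^sup>2 - (p1 s)\<^sup>2) * r1 s ^ (n - 1)" unfolding d_def
      using s True by (intro energy_gap_antimono[OF fs(1,2)] less_imp_le) auto
    also have "\<dots> \<le> K * r2 s ^ (n - 1)"
    proof (rule mult_mono)
      show "(p2 s)\<^sup>2 - (p1 s)\<^sup>2 \<le> K" using flow_onD(5)[OF fs(1), of s] s by (simp add: K_def)
      show "r1 s ^ (n - 1) \<le> r2 s ^ (n - 1)" using True s pos[of s] b_less \<open>\<beta> < c\<close> by (intro power_mono) auto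
    qed (use Kpos pos[of s] s b_less \<open>\<beta> < c\<close> in auto)
    finally have "d\<^sup>2 \<le> (K * r2 s ^ (n - 1))\<^sup>2" using \<open>0 < d\<close> by (intro power_mono) auto
    also have "\<dots> = K * (K * (r2 s ^ (n - 1))\<^sup>2)" by (simp add: power2_eq_square)
    also have "\<dots> \<le> K * C" unfolding C_def K_def
      using Kpos energy_decay[OF fs(3)] s b_less beta_pos by (intro mult_left_mono) (auto simp: K_def)
    also have "\<dots> < d\<^sup>2 / C * C" using s0(2)[OF s(1,2)] \<open>0 < C\<close> unfolding K_def by (intro mult_strict_right_mono)
    finally show False using \<open>0 < C\<close> by simp
  next
    case False
    then obtain e where e: "0 < e" "e \<le> b" "r2 e \<le> r1 e" by force
    then have le: "leads r1 p1 r2 p2 e" using lb leads[of e] by (cases "e = b") auto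
    define \<delta> where "\<delta> = W r2 p2 e - W r1 p1 e"
    have "0 < \<delta>" using le e by (auto simp: \<delta>_def leads_def)
    have W: "\<delta> \<le> W r2 p2 s" if s: "0 < s" "s < e" for s
    proof -
      have fs: "flow_on r1 p1 s e" "flow_on r2 p2 s e"
        using fl(1,2)[OF s(1)] e b_less \<open>\<beta> < c\<close> by (auto intro: flow_on_sub)
      have "\<delta> \<le> W r2 p2 s - W r1 p1 s" unfolding \<delta>_def
        by (rule ahead_persists_inner(3)[OF fs s(2)])
          (use s e le b_less pos[of e] \<open>\<beta> < c\<close> beta_pos in \<open>auto simp: leads_def\<close>)
      moreover have "0 \<le> W r1 p1 s"
        using flow_onD(3,5)[OF fs(1), of s] s by (auto simp: W_def)
      ultimately show ?thesis by simp
    qed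
    have y: "\<delta> \<le> r2 s * p2 s" if s: "0 < s" "s < e" for s
    proof -
      have "0 \<le> p2 s" using flow_onD(4)[OF fl(2)[OF s(1)], of s] s e b_less \<open>\<beta> < c\<close> by simp
      moreover have "F s \<le> 0" using F_nonpos[of s] s e b_less by simp
      ultimately have "sqrt ((p2 s)\<^sup>2 + 2 * F s) \<le> p2 s" by (intro real_le_lsqrt) auto
      then have "W r2 p2 s \<le> r2 s * p2 s" unfolding W_def
        using pos[of s] s e b_less \<open>\<beta> < c\<close> by (intro mult_left_mono) auto
      then show ?thesis using W[OF s] by simp
    qed
    define R where "R = exp (ln (r2 e) + e / \<delta>)"
    have r2R: "r2 s \<le> R" if s: "0 < s" "s < e" for s
    proof -
      have fs: "flow_on r2 p2 s e"
        using fl(2)[OF s(1)] e b_less \<open>\<beta> < c\<close> by (auto intro: flow_on_sub)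
      have rp: "0 < r2 t" if "s \<le> t" "t \<le> e" for t using pos[of t] that s e b_less \<open>\<beta> < c\<close> by auto
      have "ln (r2 s) + s / \<delta> \<le> ln (r2 e) + e / \<delta>"
      proof (rule DERIV_nonneg_imp_increasing_open[of s e "\<lambda>s. ln (r2 s) + s / \<delta>"])
        show "continuous_on {s..e} (\<lambda>s. ln (r2 s) + s / \<delta>)"
          using \<open>0 < \<delta>\<close> rp by (intro continuous_intros flow_onD[OF fs]) force+
        fix t assume t: "s < t" "t < e"
        note ft = flow_atD[OF flow_onD(6)[OF fs t]]
        have "((\<lambda>s. ln (r2 s) + s / \<delta>) has_real_derivative 1 / r2 t * (- 1 / p2 t) + 1 / \<delta>) (at t)"
          by (rule derivative_eq_intros ft(3) refl | use ft(1) \<open>0 < \<delta>\<close> in simp)+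
        moreover have "1 / (r2 t * p2 t) \<le> 1 / \<delta>"
          using y[of t] t s \<open>0 < \<delta>\<close> by (intro divide_left_mono) (auto intro: mult_pos_pos less_le_trans)
        ultimately show "\<exists>y. ((\<lambda>s. ln (r2 s) + s / \<delta>) has_real_derivative y) (at t) \<and> 0 \<le> y"
          by (intro exI[of _ "1 / r2 t * (- 1 / p2 t) + 1 / \<delta>"]) simp
      qed (use s in simp)
      then have "ln (r2 s) \<le> ln (r2 e) + e / \<delta>" using s \<open>0 < \<delta>\<close> by (meson add_increasing2 divide_pos_pos less_imp_le order_trans le_add_same_cancel1)
      then have "exp (ln (r2 s)) \<le> R" unfolding R_def by simp
      then show ?thesis using rp[of s] s by simp
    qed
    have "0 < R" by (simp add: R_def)
    obtain s0 where s0: "0 < s0" "\<And>s. 0 < s \<Longrightarrow> s < s0 \<Longrightarrow> (p2 s)\<^sup>2 + 2 * F s < (\<delta> / R)\<^sup>2"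
      using lim[of "(\<delta> / R)\<^sup>2"] \<open>0 < R\<close> \<open>0 < \<delta>\<close> by auto
    define s where "s = min s0 e / 2"
    have s: "0 < s" "s < s0" "s < e" using s0 e by (auto simp: s_def)
    have "sqrt ((p2 s)\<^sup>2 + 2 * F s) < \<delta> / R"
      using s0(2)[OF s(1,2)] \<open>0 < R\<close> \<open>0 < \<delta>\<close> by (intro real_less_lsqrt) auto
    moreover have "0 < sqrt ((p2 s)\<^sup>2 + 2 * F s)"
      using flow_onD(5)[OF fl(2)[OF s(1)], of s] s e b_less \<open>\<beta> < c\<close> by simp
    ultimately have "W r2 p2 s < R * (\<delta> / R)" unfolding W_def
      using r2R[OF s(1,3)] pos[of s] s e b_less \<open>\<beta> < c\<close> \<open>0 < R\<close> by (intro mult_le_less_imp_less) auto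
    then show False using W[OF s(1,3)] \<open>0 < R\<close> by simp
  qed
qed

lemma descent_start:
  assumes f1: "flow_on r1 p1 a M1" and f2: "flow_on r2 p2 a M2"
    and M: "a \<le> \<beta>" "\<beta> < M1" "M1 < M2" and p: "p1 M1 = 0" "p2 M2 = 0"
    and inv: "2 * (r1 M1)\<^sup>2 * F M1 + G M1 \<le> 2 * (r2 M2)\<^sup>2 * F M2 + G M2"
  obtains c where "\<beta> < c" "c < M1" "0 < r1 c" "above_leads r1 p1 r2 p2 c"
proof -
  have fM: "flow_at r2 p2 M1" using flow_onD(6)[OF f2, of M1] M by simp
  have "Q r2 p2 M2 \<le> Q r2 p2 M1"
    using M by (intro Q_antimono flow_on_sub[OF f2]) auto
  then have QM: "Q r1 p1 M1 \<le> Q r2 p2 M1" using inv p by (simp add: Q_def algebra_simps)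
  have f1': "flow_on r1 p1 \<beta> M1" and f2': "flow_on r2 p2 \<beta> M1"
    using f1 f2 M by (auto intro: flow_on_sub)
  define g where "g = (\<lambda>s. min (p2 s - p1 s) (r2 s * p2 s - r1 s * p1 s))"
  have g: "continuous_on {\<beta>..M1} g" unfolding g_def
    by (intro continuous_intros flow_onD[OF f1'] flow_onD[OF f2'])
  have gM: "0 < g M1" using flow_atD(1,2)[OF fM] p by (simp add: g_def)
  obtain c where c: "\<beta> < c" "c < M1" "\<And>s. c \<le> s \<Longrightarrow> s \<le> M1 \<Longrightarrow> 0 < g s"
  proof (cases "\<forall>s. \<beta> \<le> s \<longrightarrow> s \<le> M1 \<longrightarrow> 0 < g s")
    case True
    then show ?thesis using that[of "(\<beta> + M1) / 2"] M by (auto simp: field_simps)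
  next
    case False
    then obtain s where s: "\<beta> \<le> s" "s \<le> M1" "\<not> 0 < g s" by blast
    obtain e where e: "s \<le> e" "e < M1" "\<And>t. e < t \<Longrightarrow> t \<le> M1 \<Longrightarrow> 0 < g t"
      by (rule first_failure[of s M1 g]) (use s gM g in \<open>auto intro: continuous_on_subset\<close>)
    show ?thesis using that[of "(e + M1) / 2"] e s M by (auto simp: field_simps)
  qed
  have fc: "flow_on r1 p1 c M1" "flow_on r2 p2 c M1" using f1' f2' c by (auto intro: flow_on_sub)
  have "Q r2 p2 M1 - Q r1 p1 M1 \<le> Q r2 p2 c - Q r1 p1 c"
  proof (rule Q_diff_antimono[OF fc])
    fix s assume "c < s" "s < M1"
    then show "r1 s * p1 s \<le> r2 s * p2 s" using c(3)[of s] by (simp add: g_def)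
  qed (use c in auto)
  then have "above_leads r1 p1 r2 p2 c"
    using c(3)[of c] c(2) QM by (simp add: above_leads_def g_def)
  then show ?thesis using that c r_pos[OF fc(1), of c] by auto
qed

section \<open>Monotone pieces of a solution\<close>

definition solves :: "(real \<Rightarrow> real) \<Rightarrow> (real \<Rightarrow> real) \<Rightarrow> bool" where
  "solves u u1 \<longleftrightarrow> (\<forall>r\<ge>0. (u has_real_derivative u1 r) (at r within {0..})) \<and>
    continuous_on {0..} u1 \<and> u1 0 = 0 \<and> (u \<longlongrightarrow> 0) at_top \<and>
    (\<forall>r>0. (u1 has_real_derivative - ((real n - 1) / r * u1 r) - f (u r)) (at r))"

definition energy :: "(real \<Rightarrow> real) \<Rightarrow> (real \<Rightarrow> real) \<Rightarrow> real \<Rightarrow> real" where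
  "energy u u1 r = (u1 r)\<^sup>2 + 2 * F (u r)"

lemma solves_deriv:
  assumes "solves u u1"
  shows "0 \<le> r \<Longrightarrow> (u has_real_derivative u1 r) (at r within {0..})"
    and "0 < r \<Longrightarrow> (u has_real_derivative u1 r) (at r)"
    and "0 < r \<Longrightarrow> (u1 has_real_derivative - ((real n - 1) / r * u1 r) - f (u r)) (at r)"
proof -
  show d: "0 \<le> r \<Longrightarrow> (u has_real_derivative u1 r) (at r within {0..})"
    using assms by (simp add: solves_def)
  assume r: "0 < r"
  then show "(u1 has_real_derivative - ((real n - 1) / r * u1 r) - f (u r)) (at r)"
    using assms unfolding solves_def by blast
  have "at r within {0..} = at r" using r by (intro at_within_interior) auto
  then show "(u has_real_derivative u1 r) (at r)" using d r by simp
qed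

lemma solves_cont:
  assumes "solves u u1" "S \<subseteq> {0..}"
  shows "continuous_on S u" "continuous_on S u1" "continuous_on S (energy u u1)"
proof -
  have "continuous_on {0..} u"
    using solves_deriv(1)[OF assms(1)] by (intro DERIV_continuous_on) auto
  then show 1: "continuous_on S u" using assms(2) by (rule continuous_on_subset)
  show 2: "continuous_on S u1" using assms by (auto simp: solves_def intro: continuous_on_subset)
  show "continuous_on S (energy u u1)"
    unfolding energy_def[abs_def] by (intro continuous_intros 2 continuous_on_compose2[OF F_cont 1]) auto
qed

lemma solves_uminus:
  assumes "solves u u1"
  shows "solves (\<lambda>r. - u r) (\<lambda>r. - u1 r)"
  unfolding solves_def
proof (intro conjI allI impI)
  fix r :: real assume r: "0 < r"
  show "((\<lambda>r. - u1 r) has_real_derivative - ((real n - 1) / r * - u1 r) - f (- u r)) (at r)"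
    using DERIV_minus[OF solves_deriv(3)[OF assms r]] by (simp add: f_odd add.commute)
next
  show "((\<lambda>r. - u r) \<longlongrightarrow> 0) at_top" using assms tendsto_minus[of u 0 at_top] by (simp add: solves_def)
qed (use assms in \<open>auto simp: solves_def intro!: DERIV_minus continuous_intros\<close>)

lemma energy_deriv:
  assumes "solves u u1" "0 < r"
  shows "(energy u u1 has_real_derivative - (2 * (real n - 1) / r * (u1 r)\<^sup>2)) (at r)"
proof -
  have "((\<lambda>r. (u1 r)\<^sup>2 + 2 * F (u r)) has_real_derivative
      2 * u1 r * (- ((real n - 1) / r * u1 r) - f (u r)) + 2 * (f (u r) * u1 r)) (at r)"
    by (rule derivative_eq_intros solves_deriv(2,3)[OF assms] DERIV_chain2[OF F_deriv] refl | simp)+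
  moreover have "2 * u1 r * (- ((real n - 1) / r * u1 r) - f (u r)) + 2 * (f (u r) * u1 r)
     = - (2 * (real n - 1) / r * (u1 r)\<^sup>2)"
    by (simp add: algebra_simps power2_eq_square)
  ultimately show ?thesis unfolding energy_def[abs_def] by simp
qed

lemma energy_antimono:
  assumes "solves u u1" "0 \<le> r" "r \<le> s"
  shows "energy u u1 s \<le> energy u u1 r"
proof (rule DERIV_nonpos_imp_decreasing_open[OF assms(3)])
  show "continuous_on {r..s} (energy u u1)" using assms by (intro solves_cont) auto
  fix x assume "r < x" "x < s"
  then have "0 < x" using assms by simp
  then have "- (2 * (real n - 1) / x * (u1 x)\<^sup>2) \<le> 0" using n_ge by simp
  with energy_deriv[OF assms(1) \<open>0 < x\<close>]
  show "\<exists>y. (energy u u1 has_real_derivative y) (at x) \<and> y \<le> 0" by blast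
qed

lemma F_along_tendsto:
  assumes "solves u u1" shows "((\<lambda>r. 2 * F (u r)) \<longlongrightarrow> 0) at_top"
proof -
  have "isCont F 0" using F_deriv by (rule DERIV_isCont)
  then have "((\<lambda>r. F (u r)) \<longlongrightarrow> F 0) at_top"
    by (rule isCont_tendsto_compose) (use assms in \<open>simp add: solves_def\<close>)
  then show ?thesis using tendsto_mult_left[of "\<lambda>r. F (u r)" 0 at_top 2] by (simp add: F_0)
qed

lemma energy_nonneg:
  assumes "solves u u1" "0 \<le> r"
  shows "0 \<le> energy u u1 r"
proof (rule ccontr)
  assume neg: "\<not> ?thesis"
  then have "eventually (\<lambda>s. energy u u1 r < 2 * F (u s)) at_top"
    by (intro order_tendstoD(1)[OF F_along_tendsto[OF assms(1)]]) simp
  then obtain N where "\<And>s. N \<le> s \<Longrightarrow> energy u u1 r < 2 * F (u s)"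
    unfolding eventually_at_top_linorder by blast
  then obtain s where "r \<le> s" "energy u u1 r < 2 * F (u s)"
    using that[of "max r N"] by simp
  moreover have "2 * F (u s) \<le> energy u u1 s" by (simp add: energy_def)
  ultimately show False using energy_antimono[OF assms \<open>r \<le> s\<close>] by simp
qed

lemma energy_zero:
  assumes "solves u u1" "0 \<le> r" "energy u u1 r = 0" "r \<le> s"
  shows "u s = 0"
proof -
  have E0: "energy u u1 t = 0" if "r \<le> t" for t
    using energy_antimono[OF assms(1,2) that] energy_nonneg[OF assms(1), of t] assms(2,3) that by simp
  have u10: "u1 t = 0" if "r < t" for t
  proof -
    have "(energy u u1 has_real_derivative 0) (at t)"
      by (rule has_field_derivative_transform_within_open[of "\<lambda>_. 0" _ _ "{r<..}"]) (use that E0 in auto)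
    then have "- (2 * (real n - 1) / t * (u1 t)\<^sup>2) = 0"
      using energy_deriv[OF assms(1), of t] assms(2) that by (intro DERIV_unique) auto
    then show ?thesis using n_ge assms(2) that by auto
  qed
  have const: "u t = u r" if "r \<le> t" for t
  proof (cases "r = t")
    case False
    then have "r < t" using that by simp
    then show "u t = u r"
    proof (rule DERIV_isconst_end)
      show "continuous_on {r..t} u" using assms(2) by (intro solves_cont[OF assms(1)]) auto
      fix x assume "r < x" "x < t"
      then show "(u has_real_derivative 0) (at x)"
        using solves_deriv(2)[OF assms(1), of x] u10[of x] assms(2) by simp
    qed
  qed simp
  have "eventually (\<lambda>t. u t = u r) at_top"
    unfolding eventually_at_top_linorder using const by blast
  then have "(u \<longlongrightarrow> u r) at_top" by (rule tendsto_eventually)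
  moreover have "(u \<longlongrightarrow> 0) at_top" using assms(1) by (simp add: solves_def)
  ultimately have "u r = 0" using tendsto_unique trivial_limit_at_top_linorder by blast
  then show ?thesis using const[OF \<open>r \<le> s\<close>] by simp
qed

lemma extremum_value:
  assumes "solves u u1" "0 \<le> r" "u1 r = 0" "0 < energy u u1 r"
  shows "\<beta> < \<bar>u r\<bar>"
  using F_nonpos[of "u r"] assms by (force simp: energy_def)

lemma u_strict_decreasing:
  assumes "solves u u1" "0 \<le> x" "x < y" "\<And>t. x < t \<Longrightarrow> t < y \<Longrightarrow> u1 t < 0"
  shows "u y < u x"
proof (rule DERIV_neg_imp_decreasing_open[OF \<open>x < y\<close>])
  show "continuous_on {x..y} u" using assms by (intro solves_cont) auto
  fix t assume "x < t" "t < y"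
  then show "\<exists>d. (u has_real_derivative d) (at t) \<and> d < 0"
    using solves_deriv(2)[OF assms(1), of t] assms by (intro exI[of _ "u1 t"]) auto
qed

lemma flux_deriv:
  assumes "solves u u1" "0 < t"
  shows "((\<lambda>t. t ^ (n - 1) * u1 t) has_real_derivative - (t ^ (n - 1) * f (u t))) (at t)"
proof -
  obtain k where k: "n = Suc (Suc k)" using n_ge by (metis add_2_eq_Suc le_Suc_ex)
  have p: "((\<lambda>t. t ^ Suc k) has_real_derivative real (Suc k) * t ^ k) (at t)"
    by (rule derivative_eq_intros refl | simp)+
  have "((\<lambda>t. t ^ Suc k * u1 t) has_real_derivative
     real (Suc k) * t ^ k * u1 t + (- ((real n - 1) / t * u1 t) - f (u t)) * t ^ Suc k) (at t)"
    by (rule DERIV_mult[OF p solves_deriv(3)[OF assms]])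
  moreover have "real (Suc k) * t ^ k * u1 t + (- ((real n - 1) / t * u1 t) - f (u t)) * t ^ Suc k
     = - (t ^ Suc k * f (u t))"
    using assms(2) by (simp add: k field_simps)
  ultimately show ?thesis by (simp add: k)
qed

lemma flux_decreasing:
  assumes "solves u u1" "0 \<le> x" "x < y" "\<And>t. x < t \<Longrightarrow> t < y \<Longrightarrow> b < u t"
  shows "y ^ (n - 1) * u1 y < x ^ (n - 1) * u1 x"
proof (rule DERIV_neg_imp_decreasing_open[OF \<open>x < y\<close>, of "\<lambda>t. t ^ (n - 1) * u1 t"])
  show "continuous_on {x..y} (\<lambda>t. t ^ (n - 1) * u1 t)"
    using assms by (intro continuous_intros solves_cont) auto
  fix t assume t: "x < t" "t < y"
  then have t0: "0 < t" using assms by simp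
  then have "- (t ^ (n - 1) * f (u t)) < 0" using f_pos[OF assms(4)[OF t]] by simp
  with flux_deriv[OF assms(1) t0]
  show "\<exists>d. ((\<lambda>t. t ^ (n - 1) * u1 t) has_real_derivative d) (at t) \<and> d < 0" by blast
qed

lemma decreasing_after_maximum:
  assumes sol: "solves u u1" and "0 \<le> a" "u1 a = 0" "\<beta> < u a"
  obtains \<delta> where "0 < \<delta>" "\<And>r. a < r \<Longrightarrow> r \<le> a + \<delta> \<Longrightarrow> u1 r < 0 \<and> \<beta> < u r"
proof -
  have "continuous_on {a..a+1} u" using assms by (intro solves_cont) auto
  then have cont: "continuous (at a within {a..a+1}) u" by (auto simp: continuous_on_eq_continuous_within)
  have "0 < u a - \<beta>" using assms by simp
  then obtain d where d: "0 < d" "\<And>r. r \<in> {a..a+1} \<Longrightarrow> dist r a < d \<Longrightarrow> dist (u r) (u a) < u a - \<beta>"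
    using cont[unfolded continuous_within_eps_delta, rule_format] by blast
  define \<delta> where "\<delta> = min 1 d / 2"
  have \<delta>: "0 < \<delta>" "\<delta> < 1" "\<delta> < d" using d by (auto simp: \<delta>_def)
  have u: "\<beta> < u r" if "a \<le> r" "r \<le> a + \<delta>" for r
    using d(2)[of r] that \<delta> by (auto simp: dist_real_def abs_if split: if_splits)
  have "u1 r < 0" if r: "a < r" "r \<le> a + \<delta>" for r
  proof -
    have "r ^ (n - 1) * u1 r < a ^ (n - 1) * u1 a"
    proof (rule flux_decreasing[OF sol \<open>0 \<le> a\<close> r(1)])
      fix t assume "a < t" "t < r"
      then show "b < u t" using u[of t] r b_less by simp
    qed
    moreover have "0 < r ^ (n - 1)" using r assms by simp
    ultimately show ?thesis using \<open>u1 a = 0\<close>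
      by (metis mult_zero_right not_less mult_nonneg_nonneg less_imp_le)
  qed
  then show ?thesis using that[of \<delta>] u \<delta> by auto
qed

lemma flow_of_monotone_piece:
  assumes sol: "solves u u1" and ax: "0 \<le> a" "a < x" and u1: "\<And>t. a < t \<Longrightarrow> t < x \<Longrightarrow> u1 t < 0"
    and ends: "u1 a \<le> 0" "u1 x \<le> 0" and E: "\<And>t. a \<le> t \<Longrightarrow> t \<le> x \<Longrightarrow> 0 < energy u u1 t"
    and g: "\<And>t. a \<le> t \<Longrightarrow> t \<le> x \<Longrightarrow> g (u t) = t"
  shows "flow_on g (\<lambda>s. - u1 (g s)) (u x) (u a)"
proof -
  have cu: "continuous_on {a..x} u" using sol ax by (intro solves_cont) auto
  have ex: "\<exists>t. a \<le> t \<and> t \<le> x \<and> u t = s" if "u x \<le> s" "s \<le> u a" for s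
    using IVT2'[of u x s a] that cu ax by auto
  have gs: "a \<le> g s \<and> g s \<le> x \<and> u (g s) = s" if s: "u x \<le> s" "s \<le> u a" for s
    using ex[OF s] g by metis
  have gs': "a < g s \<and> g s < x" if s: "u x < s" "s < u a" for s
    using gs[of s] s by (metis less_imp_le order_le_less less_irrefl)
  have img: "u ` {a..x} = {u x..u a}"
  proof
    show "u ` {a..x} \<subseteq> {u x..u a}"
    proof safe
      fix t assume t: "t \<in> {a..x}"
      have "u x \<le> u t" using u_strict_decreasing[OF sol, of t x] u1 t ax by (cases "t = x") auto
      moreover have "u t \<le> u a" using u_strict_decreasing[OF sol, of a t] u1 t ax by (cases "t = a") auto
      ultimately show "u t \<in> {u x..u a}" by simp
    qed
    show "{u x..u a} \<subseteq> u ` {a..x}" using ex by (force simp: image_iff)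
  qed
  have cg: "continuous_on {u x..u a} g"
    using continuous_on_inv[OF cu compact_Icc] g unfolding img by auto
  have cp: "continuous_on {u x..u a} (\<lambda>s. - u1 (g s))"
  proof (intro continuous_intros continuous_on_compose2[OF _ cg])
    show "continuous_on {a..x} u1" using sol ax by (intro solves_cont) auto
    show "g ` {u x..u a} \<subseteq> {a..x}" using gs by auto
  qed
  have u1le: "u1 t \<le> 0" if "a \<le> t" "t \<le> x" for t
    using u1[of t] ends that by (cases "t = a \<or> t = x") auto
  show ?thesis
    unfolding flow_on_def
  proof (intro conjI ballI cg cp)
    fix s assume s: "s \<in> {u x..u a}"
    then have *: "a \<le> g s" "g s \<le> x" "u (g s) = s" using gs by auto
    show "0 \<le> g s" "0 \<le> - u1 (g s)" using * ax u1le by auto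
    show "0 < (- u1 (g s))\<^sup>2 + 2 * F s" using E[OF *(1,2)] *(3) by (simp add: energy_def)
  next
    fix s assume s: "s \<in> {u x<..<u a}"
    then have t: "a < g s" "g s < x" "u (g s) = s" using gs gs' by auto
    have n0: "u1 (g s) < 0" using u1 t by simp
    have g0: "0 < g s" using t ax by simp
    have "isCont g s" using continuous_on_interior[OF cg, of s] s by simp
    have dg: "(g has_real_derivative inverse (u1 (g s))) (at s)"
    proof (rule DERIV_inverse_function[where f = u and a = "u x" and b = "u a"])
      show "(u has_real_derivative u1 (g s)) (at (g s))" by (rule solves_deriv(2)[OF sol g0])
      show "isCont g s" by fact
    qed (use s n0 gs in auto)
    then have "(g has_real_derivative - 1 / - u1 (g s)) (at s)" by (simp add: inverse_eq_divide)
    moreover have "((\<lambda>s. - u1 (g s)) has_real_derivative (real n - 1) / g s - f s / - u1 (g s)) (at s)"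
    proof -
      have "((\<lambda>s. - u1 (g s)) has_real_derivative
        - ((- ((real n - 1) / g s * u1 (g s)) - f (u (g s))) * inverse (u1 (g s)))) (at s)"
        by (rule DERIV_minus[OF DERIV_chain2[OF solves_deriv(3)[OF sol g0] dg]])
      moreover have "- ((- ((real n - 1) / g s * u1 (g s)) - f (u (g s))) * inverse (u1 (g s)))
          = (real n - 1) / g s - f s / - u1 (g s)"
        using n0 g0 t(3) by (simp add: field_simps)
      ultimately show ?thesis by simp
    qed
    ultimately show "flow_at g (\<lambda>s. - u1 (g s)) s" using n0 g0 by (simp add: flow_at_def)
  qed
qed

lemma first_turn:
  assumes sol: "solves u u1" and a: "0 \<le> a" "u1 a = 0" "\<beta> < u a"
  obtains "\<And>r. a < r \<Longrightarrow> u1 r < 0"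
  | c where "a < c" "u1 c = 0" "\<And>r. a < r \<Longrightarrow> r < c \<Longrightarrow> u1 r < 0"
proof -
  obtain \<delta> where \<delta>: "0 < \<delta>" "\<And>r. a < r \<Longrightarrow> r \<le> a + \<delta> \<Longrightarrow> u1 r < 0 \<and> \<beta> < u r"
    using decreasing_after_maximum[OF sol a] by blast
  show ?thesis
  proof (cases "\<forall>r>a. u1 r < 0")
    case True then show ?thesis using that(1) by blast
  next
    case False
    then obtain r0 where r0: "a < r0" "\<not> u1 r0 < 0" by blast
    then have r0': "a + \<delta> < r0" using \<delta>(2)[of r0] by force
    define h where "h = (\<lambda>s. - u1 (- s))"
    have "continuous_on {- r0..- (a + \<delta>)} h" unfolding h_def
      using a \<delta> by (intro continuous_intros continuous_on_compose2[OF solves_cont(2)[OF sol order_refl]]) auto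
    then obtain e where e: "- r0 \<le> e" "e < - (a + \<delta>)" "h e = 0"
      "\<And>s. e < s \<Longrightarrow> s \<le> - (a + \<delta>) \<Longrightarrow> 0 < h s"
      by (rule first_failure) (use r0 r0' \<delta>(2)[of "\<delta> + a"] \<delta>(1) in \<open>auto simp: h_def\<close>)
    have "u1 r < 0" if "a < r" "r < - e" for r
      using \<delta>(2)[of r] e(4)[of "- r"] that by (cases "r \<le> a + \<delta>") (auto simp: h_def)
    then show ?thesis using that(2)[of "- e"] e \<delta> by (auto simp: h_def)
  qed
qed

lemma small_energy:
  assumes sol: "solves u u1" and a: "0 \<le> a" "\<And>r. a < r \<Longrightarrow> u1 r < 0" and "0 < \<epsilon>"
  shows "\<exists>x>a. energy u u1 x < \<epsilon>"
proof (rule ccontr)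
  assume neg: "\<not> ?thesis"
  have "eventually (\<lambda>s. 2 * F (u s) < \<epsilon> / 2) at_top"
    by (rule order_tendstoD(2)[OF F_along_tendsto[OF sol]]) (use \<open>0 < \<epsilon>\<close> in simp)
  then obtain N where N: "\<And>s. N \<le> s \<Longrightarrow> 2 * F (u s) < \<epsilon> / 2"
    unfolding eventually_at_top_linorder by blast
  define x where "x = max N a + 1"
  define \<kappa> where "\<kappa> = sqrt (\<epsilon> / 2)"
  have "0 < \<kappa>" using \<open>0 < \<epsilon>\<close> by (simp add: \<kappa>_def)
  have slope: "u1 s \<le> - \<kappa>" if "x \<le> s" for s
  proof -
    have "a < s" "N \<le> s" using that by (auto simp: x_def)
    then have "\<epsilon> \<le> energy u u1 s" using neg by (meson not_less)
    then have "\<epsilon> / 2 \<le> (- u1 s)\<^sup>2" using N[OF \<open>N \<le> s\<close>] by (simp add: energy_def)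
    then have "\<kappa> \<le> - u1 s" unfolding \<kappa>_def using a(2)[OF \<open>a < s\<close>] by (intro real_le_lsqrt) auto
    then show ?thesis by simp
  qed
  have bound: "u s \<le> u x - \<kappa> * (s - x)" if "x < s" for s
  proof -
    have "\<exists>z>x. z < s \<and> u s - u x = (s - x) * u1 z"
      using that a by (intro MVT2 solves_deriv(2)[OF sol]) (auto simp: x_def)
    then obtain z where z: "x < z" "u s - u x = (s - x) * u1 z" by blast
    then have "(s - x) * u1 z \<le> (s - x) * (- \<kappa>)" using slope[of z] that by (intro mult_left_mono) auto
    then show ?thesis using z by (simp add: algebra_simps)
  qed
  have "(u \<longlongrightarrow> 0) at_top" using sol by (simp add: solves_def)
  then have "eventually (\<lambda>s. - 1 < u s) at_top" by (rule order_tendstoD) simp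
  then obtain N' where N': "\<And>s. N' \<le> s \<Longrightarrow> - 1 < u s"
    unfolding eventually_at_top_linorder by blast
  define s where "s = max N' (x + (\<bar>u x\<bar> + 1) / \<kappa>)"
  have "(\<bar>u x\<bar> + 1) / \<kappa> \<le> s - x" by (simp add: s_def)
  then have "\<bar>u x\<bar> + 1 \<le> \<kappa> * (s - x)" using \<open>0 < \<kappa>\<close> by (simp add: field_simps)
  moreover have "x < s" using \<open>0 < \<kappa>\<close> by (auto simp: s_def less_max_iff_disj)
  ultimately show False using bound[of s] N'[of s] by (auto simp: s_def)
qed

lemma branch_cases:
  assumes sol: "solves u u1" and a: "0 \<le> a" "u1 a = 0" "\<beta> < u a"
  obtains (final) r p where "\<And>t. a \<le> t \<Longrightarrow> 0 \<le> u t" "\<And>\<epsilon>. 0 < \<epsilon> \<Longrightarrow> flow_on r p \<epsilon> (u a)"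
    "r (u a) = a" "p (u a) = 0"
    "\<And>\<epsilon>. 0 < \<epsilon> \<Longrightarrow> \<exists>s0>0. \<forall>s. 0 < s \<longrightarrow> s < s0 \<longrightarrow> (p s)\<^sup>2 + 2 * F s < \<epsilon>"
  | (turn) c r p where "a < c" "u1 c = 0" "u c < - \<beta>" "\<And>t. a < t \<Longrightarrow> t < c \<Longrightarrow> u1 t < 0"
    "flow_on r p (u c) (u a)" "r (u a) = a" "p (u a) = 0" "r (u c) = c" "p (u c) = 0"
proof -
  have final': thesis
    if J: "is_interval J" "a \<in> J" "J \<subseteq> {a..}" and max: "\<And>t. t \<in> J \<Longrightarrow> \<exists>t'\<in>J. t < t'"
      and u1: "\<And>t. t \<in> J \<Longrightarrow> a < t \<Longrightarrow> u1 t < 0" and pos: "\<And>t. t \<in> J \<Longrightarrow> 0 < u t"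
      and zero: "\<And>t. a \<le> t \<Longrightarrow> t \<notin> J \<Longrightarrow> u t = 0"
      and small: "\<And>\<epsilon>. 0 < \<epsilon> \<Longrightarrow> \<exists>x\<in>J. u x < \<epsilon>" "\<And>\<epsilon>. 0 < \<epsilon> \<Longrightarrow> \<exists>x\<in>J. energy u u1 x < \<epsilon>" for J
  proof -
    have btw: "t \<in> J" if "a \<le> t" "t \<le> x" "x \<in> J" for t x
      using mem_is_interval_1_I[OF J(1,2) that(3)] that by simp
    have dec: "u y < u x" if "x \<in> J" "y \<in> J" "x < y" for x y
    proof (rule u_strict_decreasing[OF sol _ that(3)])
      have "a \<le> x" using J that by auto
      then show "0 \<le> x" using a by simp
      fix t assume "x < t" "t < y"
      then show "u1 t < 0" using \<open>a \<le> x\<close> btw[of t y] that by (intro u1) auto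
    qed
    have inj: "inj_on u J" by (rule linorder_inj_onI') (use dec in force)
    define g where "g = inv_into J u"
    have g: "g (u t) = t" if "t \<in> J" for t using inj that by (simp add: g_def)
    have E: "0 < energy u u1 t" if t: "t \<in> J" for t
    proof (rule ccontr)
      assume "\<not> ?thesis"
      moreover have t0: "0 \<le> t" using J a t by auto
      ultimately have "energy u u1 t = 0" using energy_nonneg[OF sol, of t] by simp
      then have "u t = 0" using energy_zero[OF sol t0] by simp
      then show False using pos[OF t] by simp
    qed
    have flow: "flow_on g (\<lambda>s. - u1 (g s)) (u x) (u a)" if x: "x \<in> J" "a < x" for x
      using a x J btw u1 E g by (intro flow_of_monotone_piece[OF sol]) (auto intro: less_imp_le)
    have flow': "flow_on g (\<lambda>s. - u1 (g s)) \<epsilon> (u a)" if \<epsilon>: "0 < \<epsilon>" for \<epsilon>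
    proof -
      obtain x where x: "x \<in> J" "u x < \<epsilon>" using small(1)[OF \<epsilon>] by blast
      obtain y where y: "y \<in> J" "x < y" using max[OF x(1)] by blast
      have "a < y" using J x y by force
      with flow[OF y(1)] dec[OF x(1) y] x show ?thesis by (auto elim!: flow_on_sub)
    qed
    have lim: "\<exists>s0>0. \<forall>s. 0 < s \<longrightarrow> s < s0 \<longrightarrow> (- u1 (g s))\<^sup>2 + 2 * F s < \<epsilon>" if \<epsilon>: "0 < \<epsilon>" for \<epsilon>
    proof -
      obtain x where x: "x \<in> J" "energy u u1 x < \<epsilon>" using small(2)[OF \<epsilon>] by blast
      have "(- u1 (g s))\<^sup>2 + 2 * F s < \<epsilon>" if s: "0 < s" "s < u x" for s
      proof -
        obtain y where y: "y \<in> J" "u y < s" using small(1)[OF s(1)] by blast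
        have xy: "x < y"
        proof (rule ccontr)
          assume "\<not> x < y"
          then show False using dec[OF y(1) x(1)] y s by (cases "x = y") auto
        qed
        have "continuous_on {x..y} u" using x J a by (intro solves_cont[OF sol]) force
        then obtain t where t: "x \<le> t" "t \<le> y" "u t = s"
          using IVT2'[of u y s x] xy y s by auto
        have tJ: "t \<in> J" using btw[of t y] t x y J by auto
        have "energy u u1 t \<le> energy u u1 x" using t x J a by (intro energy_antimono[OF sol]) auto
        moreover have "(- u1 (g s))\<^sup>2 + 2 * F s = energy u u1 t" using g[OF tJ] t by (simp add: energy_def)
        ultimately show ?thesis using x by simp
      qed
      then show ?thesis using pos[OF x(1)] by blast
    qed
    have "0 \<le> u t" if "a \<le> t" for t using pos[of t] zero[of t] that by force
    then show thesis using flow' lim g[OF J(2)] a by (intro final[of g "\<lambda>s. - u1 (g s)"]) auto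
  qed
  show thesis
  proof (rule first_turn[OF sol a])
    assume u1: "\<And>r. a < r \<Longrightarrow> u1 r < 0"
    have lim: "(u \<longlongrightarrow> 0) at_top" using sol by (simp add: solves_def)
    have dec: "u y < u x" if "a \<le> x" "x < y" for x y
      using that a u1 by (intro u_strict_decreasing[OF sol]) auto
    have pos: "0 < u t" if "a \<le> t" for t
    proof -
      have "eventually (\<lambda>s. u s \<le> u (t + 1)) at_top"
        unfolding eventually_at_top_linorder
        using dec[of "t + 1"] that by (intro exI[of _ "t + 1"]) (force simp: order_le_less)
      then have "0 \<le> u (t + 1)" by (rule tendsto_upperbound[OF lim]) simp
      then show ?thesis using dec[of t "t + 1"] that by simp
    qed
    show thesis
    proof (rule final'[of "{a..}"])
      fix \<epsilon> :: real assume \<epsilon>: "0 < \<epsilon>"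
      show "\<exists>x\<in>{a..}. energy u u1 x < \<epsilon>" using small_energy[OF sol a(1) u1 \<epsilon>] by force
      have "eventually (\<lambda>s. u s < \<epsilon>) at_top" using lim \<epsilon> by (rule order_tendstoD)
      then have "eventually (\<lambda>s. u s < \<epsilon> \<and> a \<le> s) at_top"
        using eventually_ge_at_top[of a] by (rule eventually_conj)
      then show "\<exists>x\<in>{a..}. u x < \<epsilon>" by (auto dest!: eventually_happens)
    next
      fix t assume "t \<in> {a..}"
      then show "\<exists>t'\<in>{a..}. t < t'" by (intro bexI[of _ "t + 1"]) auto
    qed (use u1 pos in \<open>auto simp: is_interval_1\<close>)
  next
    fix c assume c: "a < c" "u1 c = 0" and u1: "\<And>r. a < r \<Longrightarrow> r < c \<Longrightarrow> u1 r < 0"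
    have dec: "u y < u x" if "a \<le> x" "x < y" "y \<le> c" for x y
      using that a u1 by (intro u_strict_decreasing[OF sol]) auto
    show thesis
    proof (cases "energy u u1 c = 0")
      case True
      have z: "u t = 0" if "c \<le> t" for t using energy_zero[OF sol _ True that] c a by simp
      have near: "\<exists>x\<in>{a..<c}. h x < \<epsilon>" if h: "h c = 0" "continuous_on {a..c} h" "0 < \<epsilon>"
        for \<epsilon> and h :: "real \<Rightarrow> real"
      proof -
        have cont: "continuous (at c within {a..c}) h"
          using h(2) c by (auto simp: continuous_on_eq_continuous_within)
        obtain d where d: "0 < d" "\<And>x. x \<in> {a..c} \<Longrightarrow> dist x c < d \<Longrightarrow> dist (h x) (h c) < \<epsilon>"
          using cont[unfolded continuous_within_eps_delta, rule_format, OF h(3)] by blast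
        define x where "x = max a (c - d / 2)"
        have "x \<in> {a..<c}" "dist x c < d" using d(1) c by (auto simp: x_def dist_real_def abs_if)
        then show ?thesis using d(2)[of x] h(1) by (intro bexI[of _ x]) (auto simp: dist_real_def)
      qed
      have sub: "{a..c} \<subseteq> {0..}" using a by auto
      show thesis
      proof (rule final'[of "{a..<c}"])
        fix \<epsilon> :: real assume \<epsilon>: "0 < \<epsilon>"
        show "\<exists>x\<in>{a..<c}. energy u u1 x < \<epsilon>" using near[OF True solves_cont(3)[OF sol sub] \<epsilon>] .
        show "\<exists>x\<in>{a..<c}. u x < \<epsilon>" using near[OF z solves_cont(1)[OF sol sub] \<epsilon>] by simp
      next
        fix t assume "t \<in> {a..<c}"
        then show "\<exists>t'\<in>{a..<c}. t < t'" by (intro bexI[of _ "(t + c) / 2"]) auto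
      next
        fix t assume "t \<in> {a..<c}"
        then show "0 < u t" using dec[of t c] z[of c] by auto
      qed (use u1 c z in \<open>auto simp: is_interval_1\<close>)
    next
      case False
      have c0: "0 \<le> c" using a c by simp
      have Ec: "0 < energy u u1 c" using False energy_nonneg[OF sol c0] by simp
      have E: "0 < energy u u1 t" if "a \<le> t" "t \<le> c" for t
        using energy_antimono[OF sol, of t c] that a Ec by simp
      have "\<beta> < \<bar>u c\<bar>" using extremum_value[OF sol c0 c(2) Ec] .
      moreover have "\<not> \<beta> < u c"
      proof
        assume uc: "\<beta> < u c"
        have "c ^ (n - 1) * u1 c < a ^ (n - 1) * u1 a"
        proof (rule flux_decreasing[OF sol a(1) c(1)])
          fix t assume "a < t" "t < c"
          then show "b < u t" using dec[of t c] uc b_less by simp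
        qed
        then show False using c a by simp
      qed
      ultimately have uc: "u c < - \<beta>" by linarith
      have inj: "inj_on u {a..c}" by (rule linorder_inj_onI') (use dec in force)
      define g where "g = inv_into {a..c} u"
      have g: "g (u t) = t" if "a \<le> t" "t \<le> c" for t using inj that by (simp add: g_def)
      have "flow_on g (\<lambda>s. - u1 (g s)) (u c) (u a)"
        using a c u1 E g by (intro flow_of_monotone_piece[OF sol]) auto
      then show thesis using turn[of c g "\<lambda>s. - u1 (g s)"] c uc u1 g[of a] g[of c] a by auto
    qed
  qed
qed

section \<open>Induction over the monotone pieces\<close>

definition alternations_from :: "(real \<Rightarrow> real) \<Rightarrow> real \<Rightarrow> nat \<Rightarrow> bool" where
  "alternations_from u a m \<longleftrightarrow> (\<exists>r :: nat \<Rightarrow> real. (\<forall>i\<le>m. a < r i) \<and>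
     (\<forall>i<m. r i < r (Suc i) \<and> u (r i) * u (r (Suc i)) < 0))"

lemma alternations_from_0: "alternations_from u a 0"
  unfolding alternations_from_def by (intro exI[of _ "\<lambda>_. a + 1"]) simp

lemma alternations_from_uminus: "alternations_from (\<lambda>r. - u r) a m = alternations_from u a m"
  by (simp add: alternations_from_def)

lemma no_alternation_if_nonneg:
  assumes "\<And>t. a \<le> t \<Longrightarrow> 0 \<le> u t"
  shows "\<not> alternations_from u a (Suc m)"
proof
  assume "alternations_from u a (Suc m)"
  then obtain r :: "nat \<Rightarrow> real" where r: "\<And>i. i \<le> Suc m \<Longrightarrow> a < r i" "u (r 0) * u (r (Suc 0)) < 0"
    unfolding alternations_from_def by blast
  have "0 \<le> u (r 0)" "0 \<le> u (r (Suc 0))" using r(1)[of 0] r(1)[of "Suc 0"] by (auto intro: assms less_imp_le)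
  then show False using r(2) by (simp add: mult_less_0_iff)
qed

lemma alternations_prepend:
  assumes sol: "solves u u1" and a: "0 \<le> a" "u1 a = 0" "\<beta> < u a"
    and c: "a < c" "u c < 0" and alt: "alternations_from u c m"
  shows "alternations_from u a (Suc m)"
proof -
  obtain \<delta> where \<delta>: "0 < \<delta>" "\<And>r. a < r \<Longrightarrow> r \<le> a + \<delta> \<Longrightarrow> u1 r < 0 \<and> \<beta> < u r"
    using decreasing_after_maximum[OF sol a] by blast
  define x where "x = min (a + \<delta>) ((a + c) / 2)"
  have x: "a < x" "x < c" using \<delta>(1) c by (auto simp: x_def min_def field_simps)
  then have ux: "0 < u x" using \<delta>(2)[of x] beta_pos by (simp add: x_def)
  obtain r where r: "\<And>i. i \<le> m \<Longrightarrow> c < r i" "\<And>i. i < m \<Longrightarrow> r i < r (Suc i) \<and> u (r i) * u (r (Suc i)) < 0"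
    using alt unfolding alternations_from_def by blast
  have cons: "alternations_from u a (Suc m)" if y: "a < y" "y \<le> c" "u y * u (r 0) < 0" for y
    unfolding alternations_from_def
  proof (intro exI[of _ "\<lambda>i. case i of 0 \<Rightarrow> y | Suc j \<Rightarrow> r j"] conjI allI impI)
    fix i assume "i \<le> Suc m"
    then show "a < (case i of 0 \<Rightarrow> y | Suc j \<Rightarrow> r j)" using y c r(1)[of "i - 1"] by (auto split: nat.split)
  next
    fix i assume i: "i < Suc m"
    then show "(case i of 0 \<Rightarrow> y | Suc j \<Rightarrow> r j) < (case Suc i of 0 \<Rightarrow> y | Suc j \<Rightarrow> r j)"
      using y r(1)[of 0] r(2)[of "i - 1"] by (auto split: nat.split)
    show "u (case i of 0 \<Rightarrow> y | Suc j \<Rightarrow> r j) * u (case Suc i of 0 \<Rightarrow> y | Suc j \<Rightarrow> r j) < 0"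
      using y i r(2)[of "i - 1"] by (auto split: nat.split)
  qed
  show ?thesis
  proof (cases m)
    case 0
    have "u x * u c < 0" using ux c by (simp add: mult_pos_neg)
    then show ?thesis unfolding alternations_from_def 0
      using x c by (intro exI[of _ "\<lambda>i. if i = 0 then x else c"]) auto
  next
    case (Suc j)
    then have "u (r 0) \<noteq> 0" using r(2)[of 0] by auto
    then consider "u (r 0) < 0" | "0 < u (r 0)" by linarith
    then show ?thesis
    proof cases
      case 1 then show ?thesis using x ux by (intro cons[of x]) (auto simp: mult_pos_neg)
    next
      case 2 then show ?thesis using c by (intro cons[of c]) (auto simp: mult_neg_pos)
    qed
  qed
qed

lemma alternations_drop:
  assumes sol: "solves u u1" and a: "0 \<le> a" and c: "a < c" "u c < 0"
    and u1: "\<And>t. a < t \<Longrightarrow> t < c \<Longrightarrow> u1 t < 0" and alt: "alternations_from u a (Suc m)"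
  shows "alternations_from u c m"
proof (cases m)
  case 0 then show ?thesis by (simp add: alternations_from_0)
next
  case (Suc j)
  obtain r where r: "\<And>i. i \<le> Suc m \<Longrightarrow> a < r i"
    "\<And>i. i < Suc m \<Longrightarrow> r i < r (Suc i)" "\<And>i. i < Suc m \<Longrightarrow> u (r i) * u (r (Suc i)) < 0"
    using alt unfolding alternations_from_def by blast
  have mono: "r k \<le> r i" if "k \<le> i" "i \<le> Suc m" for k i
    using that by (induction i rule: dec_induct) (auto intro: order_trans[OF _ less_imp_le[OF r(2)]])
  have dec: "u y < u x" if "a \<le> x" "x < y" "y \<le> c" for x y
    using that a u1 by (intro u_strict_decreasing[OF sol]) auto
  show ?thesis
  proof (cases "c < r 1")
    case True
    show ?thesis unfolding alternations_from_def
    proof (intro exI[of _ "\<lambda>i. r (Suc i)"] conjI allI impI)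
      fix i assume "i \<le> m" then show "c < r (Suc i)" using mono[of 1 "Suc i"] True by simp
    qed (use r in auto)
  next
    case False
    have "u (r 1) < u (r 0)" using dec[of "r 0" "r 1"] r(1)[of 0] r(2)[of 0] False by simp
    moreover have "u (r 0) * u (r 1) < 0" using r(3)[of 0] by simp
    ultimately have n1: "u (r 1) < 0" by (auto simp: mult_less_0_iff)
    have "u (r 1) * u (r 2) < 0" using r(3)[of 1] Suc by (simp add: numeral_2_eq_2)
    then have p2: "0 < u (r 2)" using n1 by (auto simp: mult_less_0_iff)
    have c2: "c < r 2"
    proof (rule ccontr)
      assume "\<not> ?thesis"
      then have "u (r 2) < u (r 1)"
        using dec[of "r 1" "r 2"] r(1)[of 1] r(2)[of 1] Suc by (simp add: numeral_2_eq_2)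
      then show False using n1 p2 by simp
    qed
    have "isCont u c" using solves_deriv(2)[OF sol, of c] a c by (intro DERIV_isCont) auto
    then have "(u \<longlongrightarrow> u c) (at_right c)" by (simp add: isCont_def filterlim_at_split)
    then have "eventually (\<lambda>y. u y < 0) (at_right c)" using c(2) by (rule order_tendstoD)
    moreover have "eventually (\<lambda>y. c < y \<and> y < r 2) (at_right c)"
      using c2 by (auto simp: eventually_at_right_field)
    ultimately have "eventually (\<lambda>y. u y < 0 \<and> c < y \<and> y < r 2) (at_right c)" by (rule eventually_conj)
    then obtain y where y: "u y < 0" "c < y" "y < r 2"
      using eventually_happens[of _ "at_right c"] by auto
    show ?thesis unfolding alternations_from_def
    proof (intro exI[of _ "\<lambda>i. if i = 0 then y else r (Suc i)"] conjI allI impI)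
      fix i assume "i \<le> m"
      then show "c < (if i = 0 then y else r (Suc i))" using mono[of 2 "Suc i"] c2 y by auto
    next
      fix i assume i: "i < m"
      show "(if i = 0 then y else r (Suc i)) < (if Suc i = 0 then y else r (Suc (Suc i)))"
        using y r(2)[of "Suc i"] i by (auto simp: numeral_2_eq_2)
      show "u (if i = 0 then y else r (Suc i)) * u (if Suc i = 0 then y else r (Suc (Suc i))) < 0"
        using y p2 r(3)[of "Suc i"] i by (auto simp: numeral_2_eq_2 mult_neg_pos)
    qed
  qed
qed

lemma next_extremum:
  assumes fl: "flow_on r1 p1 m1 M1" "flow_on r2 p2 m2 M2"
    and M: "\<beta> < M1" "M1 < M2" "m1 < - \<beta>" "m2 < - \<beta>"
    and p: "p1 M1 = 0" "p2 M2 = 0" "p1 m1 = 0" "p2 m2 = 0"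
    and inv: "2 * (r1 M1)\<^sup>2 * F M1 + G M1 \<le> 2 * (r2 M2)\<^sup>2 * F M2 + G M2"
  shows "m2 < m1" "2 * (r1 m1)\<^sup>2 * F m1 + G m1 \<le> 2 * (r2 m2)\<^sup>2 * F m2 + G m2"
proof -
  have "flow_on r1 p1 \<beta> M1" "flow_on r2 p2 \<beta> M2"
    using fl M beta_pos by (auto intro: flow_on_sub)
  from descent_start[OF this order_refl M(1,2) p(1,2) inv]
  obtain c where c: "\<beta> < c" "c < M1" "0 < r1 c" "above_leads r1 p1 r2 p2 c" by blast
  define m where "m = max m1 m2"
  have flm: "flow_on r1 p1 m c" "flow_on r2 p2 m c"
    using fl c M by (auto simp: m_def intro: flow_on_sub)
  have *: "r1 m * p1 m < r2 m * p2 m \<and> Q r1 p1 m \<le> Q r2 p2 m"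
    using full_descent[OF flm _ c(1,3,4)] M by (simp add: m_def)
  have "0 \<le> r1 m * p1 m"
    using flow_onD(3,4)[OF flm(1), of m] c M beta_pos by (simp add: m_def)
  with * have "p2 m \<noteq> 0" by auto
  then show m: "m2 < m1" using p by (auto simp: m_def max_def split: if_splits)
  then have "m = m1" by (simp add: m_def)
  have "flow_on r2 p2 m2 m1" using fl(2) M beta_pos by (auto intro: flow_on_sub)
  then have "Q r2 p2 m1 \<le> Q r2 p2 m2" using m M by (intro Q_antimono) auto
  then have "Q r1 p1 m1 \<le> Q r2 p2 m2" using * \<open>m = m1\<close> by simp
  then show "2 * (r1 m1)\<^sup>2 * F m1 + G m1 \<le> 2 * (r2 m2)\<^sup>2 * F m2 + G m2"
    using p by (simp add: Q_def algebra_simps)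
qed

lemma different_alternations:
  assumes "solves u u1" "solves v v1" "0 \<le> a" "0 \<le> a'" "u1 a = 0" "v1 a' = 0" "\<beta> < u a" "u a < v a'"
    and "2 * a\<^sup>2 * F (u a) + G (u a) \<le> 2 * a'\<^sup>2 * F (v a') + G (v a')"
    and "alternations_from u a j" "\<not> alternations_from u a (Suc j)"
    and "alternations_from v a' j" "\<not> alternations_from v a' (Suc j)"
  shows False
  using assms
proof (induction j arbitrary: u u1 v v1 a a')
  case (0 u u1 v v1 a a')
  have vb: "\<beta> < v a'" using 0 by simp
  show False
  proof (rule branch_cases[OF 0(1,3,5,7)])
    fix c assume "a < c" "u c < - \<beta>"
    then show False
      using alternations_prepend[OF 0(1,3,5,7), of c 0] alternations_from_0[of u c] 0 beta_pos by simp
  next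
    fix r1 p1 assume f1: "\<And>\<epsilon>. 0 < \<epsilon> \<Longrightarrow> flow_on r1 p1 \<epsilon> (u a)" "r1 (u a) = a" "p1 (u a) = 0"
    show False
    proof (rule branch_cases[OF 0(2,4,6) vb])
      fix c assume "a' < c" "v c < - \<beta>"
      then show False
        using alternations_prepend[OF 0(2,4,6) vb, of c 0] alternations_from_0[of v c] 0 beta_pos by simp
    next
      fix r2 p2 assume f2: "\<And>\<epsilon>. 0 < \<epsilon> \<Longrightarrow> flow_on r2 p2 \<epsilon> (v a')" "r2 (v a') = a'" "p2 (v a') = 0"
        and lim: "\<And>\<epsilon>. 0 < \<epsilon> \<Longrightarrow> \<exists>s0>0. \<forall>s. 0 < s \<longrightarrow> s < s0 \<longrightarrow> (p2 s)\<^sup>2 + 2 * F s < \<epsilon>"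
      obtain c where c: "\<beta> < c" "c < u a" "0 < r1 c" "above_leads r1 p1 r2 p2 c"
        by (rule descent_start[OF f1(1)[OF beta_pos] f2(1)[OF beta_pos]]) (use 0 f1 f2 in auto)
      show False
      proof (rule final_descent_False[OF _ _ c(1,3,4) lim])
        fix \<epsilon> :: real assume "0 < \<epsilon>"
        then show "flow_on r1 p1 \<epsilon> c" "flow_on r2 p2 \<epsilon> c"
          using f1(1)[of \<epsilon>] f2(1)[of \<epsilon>] c(2) 0(8) by (auto elim!: flow_on_sub)
      qed
    qed
  qed
next
  case (Suc j u u1 v v1 a a')
  note S = Suc.prems
  have vb: "\<beta> < v a'" using S by simp
  show False
  proof (rule branch_cases[OF S(1,3,5,7)])
    assume "\<And>t. a \<le> t \<Longrightarrow> 0 \<le> u t"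
    then show False using no_alternation_if_nonneg[of a u j] S by simp
  next
    fix c r1 p1 assume c: "a < c" "u1 c = 0" "u c < - \<beta>" and u1: "\<And>t. a < t \<Longrightarrow> t < c \<Longrightarrow> u1 t < 0"
      and f1: "flow_on r1 p1 (u c) (u a)" "r1 (u a) = a" "p1 (u a) = 0" "r1 (u c) = c" "p1 (u c) = 0"
    show False
    proof (rule branch_cases[OF S(2,4,6) vb])
      assume "\<And>t. a' \<le> t \<Longrightarrow> 0 \<le> v t"
      then show False using no_alternation_if_nonneg[of a' v j] S by simp
    next
      fix d r2 p2 assume d: "a' < d" "v1 d = 0" "v d < - \<beta>" and v1: "\<And>t. a' < t \<Longrightarrow> t < d \<Longrightarrow> v1 t < 0"
        and f2: "flow_on r2 p2 (v d) (v a')" "r2 (v a') = a'" "p2 (v a') = 0" "r2 (v d) = d" "p2 (v d) = 0"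
      have neg: "u c < 0" "v d < 0" using c d beta_pos by auto
      note nx = next_extremum[OF f1(1) f2(1) S(7,8) c(3) d(3) f1(3) f2(3) f1(5) f2(5)]
      have inv: "v d < u c" "2 * c\<^sup>2 * F (u c) + G (u c) \<le> 2 * d\<^sup>2 * F (v d) + G (v d)"
        using nx S(9) f1 f2 by auto
      show False
      proof (rule Suc.IH[OF solves_uminus[OF S(1)] solves_uminus[OF S(2)], of c d])
        show "alternations_from (\<lambda>r. - u r) c j" "alternations_from (\<lambda>r. - v r) d j"
          using alternations_drop[OF S(1,3) c(1) neg(1) u1 S(10)] alternations_drop[OF S(2,4) d(1) neg(2) v1 S(12)]
          by (simp_all add: alternations_from_uminus)
        show "\<not> alternations_from (\<lambda>r. - u r) c (Suc j)" "\<not> alternations_from (\<lambda>r. - v r) d (Suc j)"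
          using alternations_prepend[OF S(1,3,5,7) c(1) neg(1), of "Suc j"]
            alternations_prepend[OF S(2,4,6) vb d(1) neg(2), of "Suc j"] S(11,13)
          by (auto simp: alternations_from_uminus)
      qed (use c d S(3,4) inv in \<open>auto simp: F_even G_even\<close>)
    qed
  qed
qed

section \<open>Uniqueness for the initial value problem\<close>

lemma solution_gap:
  assumes "solves u u1" "solves v v1" "0 \<le> e" "u e = v e"
    and D: "\<And>s. s \<in> {e..e+\<delta>} \<Longrightarrow> \<bar>u1 s - v1 s\<bar> \<le> D" and t: "t \<in> {e..e+\<delta>}"
  shows "\<bar>u t - v t\<bar> \<le> D * \<delta>"
proof -
  have "\<bar>(u t - v t) - (u e - v e)\<bar> \<le> D * \<bar>t - e\<bar>"
  proof (rule lipschitz_of_deriv[where h' = "\<lambda>s. u1 s - v1 s" and a = e and c = "e + \<delta>"])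
    fix s assume "s \<in> {e..e+\<delta>}"
    then have "s \<ge> 0" using assms by simp
    then show "((\<lambda>s. u s - v s) has_real_derivative u1 s - v1 s) (at s within {e..e + \<delta>})"
      using assms(3) by (intro DERIV_diff DERIV_subset[OF solves_deriv(1)[OF assms(1)]]
          DERIV_subset[OF solves_deriv(1)[OF assms(2)]]) auto
  qed (use D t in auto)
  also have "\<dots> \<le> D * \<delta>" using D[OF t] t by (intro mult_left_mono) auto
  finally show ?thesis using assms(4) by simp
qed

lemma local_uniqueness_slope:
  assumes u: "solves u u1" and v: "solves v v1" and e: "0 < e" "u e = v e" "u1 e = v1 e" "u1 e \<noteq> 0"
  shows "\<exists>\<delta>>0. \<forall>t\<in>{e..e+\<delta>}. u t = v t \<and> u1 t = v1 t"
proof -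
  define \<kappa> where "\<kappa> = \<bar>u1 e\<bar> / 2"
  have \<kappa>: "0 < \<kappa>" using e by (simp add: \<kappa>_def)
  obtain \<delta>1 where \<delta>1: "0 < \<delta>1" "\<And>t. e \<le> t \<Longrightarrow> t \<le> e + \<delta>1 \<Longrightarrow> \<bar>u1 t - u1 e\<bar> < \<kappa>"
    by (rule continuous_near[OF solves_cont(2)[OF u order_refl] less_imp_le[OF e(1)] \<kappa>]) blast
  obtain \<delta>2 where \<delta>2: "0 < \<delta>2" "\<And>t. e \<le> t \<Longrightarrow> t \<le> e + \<delta>2 \<Longrightarrow> \<bar>v1 t - v1 e\<bar> < \<kappa>"
    by (rule continuous_near[OF solves_cont(2)[OF v order_refl] less_imp_le[OF e(1)] \<kappa>]) blast
  obtain \<delta>3 where \<delta>3: "0 < \<delta>3" "\<And>t. e \<le> t \<Longrightarrow> t \<le> e + \<delta>3 \<Longrightarrow> \<bar>u t - u e\<bar> < 1"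
    by (rule continuous_near[OF solves_cont(1)[OF u order_refl] less_imp_le[OF e(1)] zero_less_one]) blast
  obtain \<delta>4 where \<delta>4: "0 < \<delta>4" "\<And>t. e \<le> t \<Longrightarrow> t \<le> e + \<delta>4 \<Longrightarrow> \<bar>v t - v e\<bar> < 1"
    by (rule continuous_near[OF solves_cont(1)[OF v order_refl] less_imp_le[OF e(1)] zero_less_one]) blast
  define S where "S = {u e - 1..u e + 1}"
  have "compact (f ` S)" unfolding S_def
    by (intro compact_continuous_image continuous_on_subset[OF f_cont]) auto
  then obtain L where L: "0 < L" "\<And>x. x \<in> S \<Longrightarrow> \<bar>f x\<bar> \<le> L"
    using bounded_pos[of "f ` S"] compact_imp_bounded by auto
  define K where "K = 12 * (real n - 1) * \<kappa> / e"
  have K: "0 \<le> K" using n_ge \<kappa> e by (simp add: K_def)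
  define \<delta> where "\<delta> = min (min \<delta>1 \<delta>2) (min (min \<delta>3 \<delta>4) (\<kappa> / (K + 2 * L)))"
  have \<delta>: "0 < \<delta>" "\<delta> \<le> \<delta>1" "\<delta> \<le> \<delta>2" "\<delta> \<le> \<delta>3" "\<delta> \<le> \<delta>4" "\<delta> \<le> \<kappa> / (K + 2 * L)"
    using \<delta>1(1) \<delta>2(1) \<delta>3(1) \<delta>4(1) \<kappa> K L(1) by (auto simp: \<delta>_def)
  have \<delta>K: "(K + 2 * L) * \<delta> \<le> \<kappa>" using \<delta>(6) K L(1) by (simp add: field_simps)
  have sub: "{e..e+\<delta>} \<subseteq> {0..}" using e by auto
  have half: "\<bar>u1 t - v1 t\<bar> \<le> D / 2"
    if D: "\<And>s. s \<in> {e..e+\<delta>} \<Longrightarrow> \<bar>u1 s - v1 s\<bar> \<le> D" and t: "t \<in> {e..e+\<delta>}" for D t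
  proof -
    have D0: "0 \<le> D" using D[OF t] by simp
    have sm: "2 * \<kappa> \<le> \<bar>u1 s + v1 s\<bar>" "\<bar>u1 s + v1 s\<bar> \<le> 6 * \<kappa>" if "s \<in> {e..e+\<delta>}" for s
      using \<delta>1(2)[of s] \<delta>2(2)[of s] that \<delta> e(3) unfolding \<kappa>_def by (auto simp: abs_if split: if_splits)
    have sq: "\<bar>(u1 s)\<^sup>2 - (v1 s)\<^sup>2\<bar> = \<bar>u1 s + v1 s\<bar> * \<bar>u1 s - v1 s\<bar>" for s
      by (simp add: abs_mult[symmetric] power2_eq_square algebra_simps)
    have "\<bar>(energy u u1 t - energy v v1 t) - (energy u u1 e - energy v v1 e)\<bar> \<le> K * D * \<bar>t - e\<bar>"
    proof (rule lipschitz_of_deriv[where a = e and c = "e + \<delta>"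
          and h' = "\<lambda>s. - (2 * (real n - 1) / s * (u1 s)\<^sup>2) - - (2 * (real n - 1) / s * (v1 s)\<^sup>2)"])
      fix s assume s: "s \<in> {e..e+\<delta>}"
      then have s0: "0 < s" "e \<le> s" using e by auto
      show "((\<lambda>s. energy u u1 s - energy v v1 s) has_real_derivative
          - (2 * (real n - 1) / s * (u1 s)\<^sup>2) - - (2 * (real n - 1) / s * (v1 s)\<^sup>2)) (at s within {e..e+\<delta>})"
        using energy_deriv[OF u s0(1)] energy_deriv[OF v s0(1)]
        by (intro DERIV_diff) (auto intro: has_field_derivative_at_within)
      have "\<bar>- (2 * (real n - 1) / s * (u1 s)\<^sup>2) - - (2 * (real n - 1) / s * (v1 s)\<^sup>2)\<bar>
          = 2 * (real n - 1) / s * \<bar>(u1 s)\<^sup>2 - (v1 s)\<^sup>2\<bar>"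
      proof -
        have "- (2 * (real n - 1) / s * (u1 s)\<^sup>2) - - (2 * (real n - 1) / s * (v1 s)\<^sup>2)
          = - (2 * (real n - 1) / s * ((u1 s)\<^sup>2 - (v1 s)\<^sup>2))" by (simp add: algebra_simps diff_divide_distrib)
        then show ?thesis using n_ge s0 by (simp add: abs_mult)
      qed
      also have "\<dots> \<le> 2 * (real n - 1) / e * (6 * \<kappa> * D)"
        unfolding sq using sm[OF s] D[OF s] n_ge e s0 \<kappa>
        by (intro mult_mono divide_left_mono) auto
      also have "\<dots> = K * D" by (simp add: K_def)
      finally show "\<bar>- (2 * (real n - 1) / s * (u1 s)\<^sup>2) - - (2 * (real n - 1) / s * (v1 s)\<^sup>2)\<bar> \<le> K * D" .
    qed (use t in auto)
    also have "\<dots> \<le> K * D * \<delta>" using t K D0 by (intro mult_left_mono) auto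
    finally have en: "\<bar>energy u u1 t - energy v v1 t\<bar> \<le> K * D * \<delta>" using e by (simp add: energy_def)
    have S: "u t \<in> S" "v t \<in> S" using \<delta>3(2)[of t] \<delta>4(2)[of t] t \<delta> e(2) by (auto simp: S_def)
    have "\<bar>F (u t) - F (v t)\<bar> \<le> L * \<bar>u t - v t\<bar>"
      using lipschitz_of_deriv[of "u e - 1" "u e + 1" F f L "u t" "v t"] S L
      by (auto simp: S_def intro: has_field_derivative_at_within[OF F_deriv])
    also have "\<dots> \<le> L * (D * \<delta>)"
      using solution_gap[OF u v _ e(2) D t] e L by (intro mult_left_mono) auto
    finally have "\<bar>(u1 t)\<^sup>2 - (v1 t)\<^sup>2\<bar> \<le> K * D * \<delta> + 2 * (L * (D * \<delta>))"
      using en by (simp add: energy_def abs_le_iff)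
    then have "\<bar>u1 t + v1 t\<bar> * \<bar>u1 t - v1 t\<bar> \<le> D * ((K + 2 * L) * \<delta>)"
      unfolding sq by (simp add: algebra_simps)
    moreover have "2 * \<kappa> * \<bar>u1 t - v1 t\<bar> \<le> \<bar>u1 t + v1 t\<bar> * \<bar>u1 t - v1 t\<bar>"
      using sm[OF t] by (intro mult_right_mono) auto
    moreover have "D * ((K + 2 * L) * \<delta>) \<le> D * \<kappa>" using D0 \<delta>K by (intro mult_left_mono)
    ultimately have "\<kappa> * (2 * \<bar>u1 t - v1 t\<bar>) \<le> \<kappa> * D" by (simp add: algebra_simps)
    then show ?thesis using \<kappa> by simp
  qed
  have u1: "u1 t - v1 t = 0" if "t \<in> {e..e+\<delta>}" for t
    by (rule zero_if_halved[of e "e + \<delta>" "\<lambda>t. u1 t - v1 t", OF _ _ half that])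
      (use solves_cont(2)[OF u sub] solves_cont(2)[OF v sub] \<delta> in \<open>auto intro: continuous_intros\<close>)
  have "u t = v t" if t: "t \<in> {e..e+\<delta>}" for t
    using solution_gap[OF u v _ e(2) _ t, of 0] u1 e(1) by simp
  with u1 \<delta>(1) show ?thesis by (intro exI[of _ \<delta>]) auto
qed

lemma local_uniqueness_maximum:
  assumes u: "solves u u1" and v: "solves v v1" and e: "0 \<le> e" "u e = v e" "u1 e = v1 e" "\<beta> < u e"
  shows "\<exists>\<delta>>0. \<forall>t\<in>{e..e+\<delta>}. u t = v t \<and> u1 t = v1 t"
proof -
  define M where "M = u e / 2"
  have M: "0 < M" using e beta_pos by (simp add: M_def)
  obtain \<delta>3 where \<delta>3: "0 < \<delta>3" "\<And>t. e \<le> t \<Longrightarrow> t \<le> e + \<delta>3 \<Longrightarrow> \<bar>u t - u e\<bar> < M"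
    by (rule continuous_near[OF solves_cont(1)[OF u order_refl] e(1) M]) blast
  obtain \<delta>4 where \<delta>4: "0 < \<delta>4" "\<And>t. e \<le> t \<Longrightarrow> t \<le> e + \<delta>4 \<Longrightarrow> \<bar>v t - v e\<bar> < M"
    by (rule continuous_near[OF solves_cont(1)[OF v order_refl] e(1) M]) blast
  define S where "S = {u e - M..u e + M}"
  have Spos: "S \<subseteq> {0<..}" using M by (auto simp: S_def M_def)
  obtain f' where f': "\<And>x. 0 < x \<Longrightarrow> (f has_real_derivative f' x) (at x)" "continuous_on {0<..} f'"
    using f_C1 unfolding C1_differentiable_on_def has_real_derivative_iff_has_vector_derivative by auto
  have "compact (f' ` S)" using f'(2) Spos unfolding S_def
    by (intro compact_continuous_image) (auto intro: continuous_on_subset)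
  then obtain L where L: "0 < L" "\<And>x. x \<in> S \<Longrightarrow> \<bar>f' x\<bar> \<le> L"
    using bounded_pos[of "f' ` S"] compact_imp_bounded by auto
  define \<delta> where "\<delta> = min (min \<delta>3 \<delta>4) (min 1 (1 / (2 * L)))"
  have \<delta>: "0 < \<delta>" "\<delta> \<le> \<delta>3" "\<delta> \<le> \<delta>4" "\<delta> \<le> 1" "\<delta> \<le> 1 / (2 * L)"
    using \<delta>3(1) \<delta>4(1) L(1) by (auto simp: \<delta>_def)
  have "L * \<delta> \<le> 1 / 2" using \<delta>(5) L(1) by (simp add: field_simps)
  moreover have "\<delta> * (L * \<delta>) \<le> 1 * (L * \<delta>)" using \<delta> L(1) by (intro mult_right_mono) auto
  ultimately have \<delta>L: "\<delta> * (L * \<delta>) \<le> 1 / 2" by simp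
  have sub: "{e..e+\<delta>} \<subseteq> {0..}" using e by auto
  have half: "\<bar>u1 t - v1 t\<bar> \<le> D / 2"
    if D: "\<And>s. s \<in> {e..e+\<delta>} \<Longrightarrow> \<bar>u1 s - v1 s\<bar> \<le> D" and t: "t \<in> {e..e+\<delta>}" for D t
  proof (cases "t = e")
    case True
    then show ?thesis using D[OF t] e by simp
  next
    case False
    then have et: "e < t" using t by simp
    have D0: "0 \<le> D" using D[OF t] by simp
    have fd: "\<bar>f (u s) - f (v s)\<bar> \<le> L * (D * \<delta>)" if s: "s \<in> {e..e+\<delta>}" for s
    proof -
      have "u s \<in> S" "v s \<in> S" using \<delta>3(2)[of s] \<delta>4(2)[of s] s \<delta> e(2) by (auto simp: S_def)
      moreover have "(f has_real_derivative f' x) (at x within S)" if "x \<in> S" for x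
        using f'(1)[of x] Spos that by (auto intro: has_field_derivative_at_within)
      ultimately have "\<bar>f (u s) - f (v s)\<bar> \<le> L * \<bar>u s - v s\<bar>"
        unfolding S_def by (intro lipschitz_of_deriv[where h' = f']) (auto simp: S_def L(2))
      also have "\<dots> \<le> L * (D * \<delta>)"
        using solution_gap[OF u v e(1,2) D s] L by (intro mult_left_mono) auto
      finally show ?thesis .
    qed
    define z where "z = (\<lambda>s. s ^ (n - 1) * u1 s - s ^ (n - 1) * v1 s)"
    have cz: "continuous_on {e..t} z" unfolding z_def
      using e by (intro continuous_intros solves_cont(2)[OF u] solves_cont(2)[OF v]) auto
    have dz: "(z has_real_derivative - (s ^ (n - 1) * f (u s)) - - (s ^ (n - 1) * f (v s))) (at s)"
      if "e < s" for s
      unfolding z_def using e that by (intro DERIV_diff flux_deriv[OF u] flux_deriv[OF v]) auto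
    obtain l s where s: "e < s" "s < t" and l: "DERIV z s :> l" "z t - z e = (t - e) * l"
      using MVT[OF et cz] dz real_differentiable_def by blast
    have "l = - (s ^ (n - 1) * (f (u s) - f (v s)))"
      using DERIV_unique[OF l(1) dz[OF s(1)]] by (simp add: algebra_simps)
    then have labs: "\<bar>l\<bar> = s ^ (n - 1) * \<bar>f (u s) - f (v s)\<bar>"
      using s e by (simp add: abs_mult)
    have "t ^ (n - 1) * \<bar>u1 t - v1 t\<bar> = \<bar>z t\<bar>"
      using et e by (simp add: z_def abs_mult right_diff_distrib[symmetric])
    also have "\<dots> = (t - e) * \<bar>l\<bar>" using l(2) e(3) et by (simp add: z_def abs_mult)
    also have "\<dots> \<le> \<delta> * (t ^ (n - 1) * (L * (D * \<delta>)))"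
      unfolding labs using fd[of s] s t e D0 L \<delta> by (intro mult_mono power_mono) auto
    also have "\<dots> = t ^ (n - 1) * (D * (\<delta> * (L * \<delta>)))" by (simp add: algebra_simps)
    finally have "\<bar>u1 t - v1 t\<bar> \<le> D * (\<delta> * (L * \<delta>))" using et e by simp
    also have "\<dots> \<le> D * (1 / 2)" using \<delta>L D0 by (rule mult_left_mono)
    finally show ?thesis by simp
  qed
  have u1: "u1 t - v1 t = 0" if "t \<in> {e..e+\<delta>}" for t
    by (rule zero_if_halved[of e "e + \<delta>" "\<lambda>t. u1 t - v1 t", OF _ _ half that])
      (use solves_cont(2)[OF u sub] solves_cont(2)[OF v sub] \<delta> in \<open>auto intro: continuous_intros\<close>)
  have "u t = v t" if t: "t \<in> {e..e+\<delta>}" for t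
    using solution_gap[OF u v e(1,2) _ t, of 0] u1 by simp
  with u1 \<delta>(1) show ?thesis by (intro exI[of _ \<delta>]) auto
qed

lemma local_uniqueness:
  assumes u: "solves u u1" and v: "solves v v1" and e: "0 \<le> e" "u e = v e" "u1 e = v1 e"
    and E: "0 < energy u u1 e"
  shows "\<exists>\<delta>>0. \<forall>t\<in>{e..e+\<delta>}. u t = v t \<and> u1 t = v1 t"
proof (cases "u1 e = 0")
  case False
  then have "e \<noteq> 0" using u by (auto simp: solves_def)
  then show ?thesis using local_uniqueness_slope[OF u v _ e(2,3) False] e by simp
next
  case True
  have "\<beta> < \<bar>u e\<bar>" by (rule extremum_value[OF u e(1) True E])
  then consider "\<beta> < u e" | "\<beta> < - u e" by linarith
  then show ?thesis
  proof cases
    case 1 then show ?thesis using local_uniqueness_maximum[OF u v e] by simp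
  next
    case 2
    then show ?thesis
      using local_uniqueness_maximum[OF solves_uminus[OF u] solves_uminus[OF v] e(1)] e by simp
  qed
qed

lemma uniqueness:
  assumes u: "solves u u1" and v: "solves v v1" and "u 0 = v 0" "0 \<le> r"
  shows "u r = v r"
proof (rule ccontr)
  assume neq: "u r \<noteq> v r"
  define h where "h = (\<lambda>t. \<bar>u t - v t\<bar> + \<bar>u1 t - v1 t\<bar>)"
  have sub: "{0..r} \<subseteq> {0..}" by auto
  have ch: "continuous_on {0..r} h" unfolding h_def
    by (intro continuous_intros solves_cont(1,2)[OF u sub] solves_cont(1,2)[OF v sub])
  have h0: "h 0 = 0" using assms by (simp add: h_def solves_def)
  have hr: "0 < h r" using neq by (simp add: h_def)
  obtain e where e: "0 \<le> e" "e < r" "h e = 0" "\<And>s. e < s \<Longrightarrow> s \<le> r \<Longrightarrow> 0 < h s"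
    by (rule first_failure[OF ch \<open>0 \<le> r\<close> hr]) (use h0 in auto)
  have eq: "u e = v e" "u1 e = v1 e" using e(3) by (auto simp: h_def)
  have "0 < energy u u1 e"
  proof (rule ccontr)
    assume "\<not> ?thesis"
    then have z: "energy u u1 e = 0" using energy_nonneg[OF u e(1)] by simp
    then have "energy v v1 e = 0" using eq by (simp add: energy_def)
    then have "u r = 0" "v r = 0"
      using energy_zero[OF u e(1) z, of r] energy_zero[OF v e(1), of r] e(2) by auto
    then show False using neq by simp
  qed
  from local_uniqueness[OF u v e(1) eq this]
  obtain \<delta> where \<delta>: "0 < \<delta>" "\<forall>t\<in>{e..e+\<delta>}. u t = v t \<and> u1 t = v1 t" by blast
  define s where "s = min (e + \<delta>) r"
  have "e < s" "s \<le> r" "s \<in> {e..e+\<delta>}" using \<delta>(1) e(2) by (auto simp: s_def)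
  then show False using e(4)[of s] \<delta>(2) by (simp add: h_def)
qed

lemma initial_value:
  assumes u: "solves u u1" and "0 < u 0"
  shows "\<beta> < u 0"
proof -
  have "energy u u1 0 \<noteq> 0" using energy_zero[OF u order_refl _ order_refl] assms(2) by auto
  then have "0 < energy u u1 0" using energy_nonneg[OF u order_refl] by simp
  then show ?thesis using extremum_value[OF u order_refl] u assms(2) by (auto simp: solves_def)
qed

lemma initial_value_le:
  assumes u: "solves u u1" and v: "solves v v1" and "0 < u 0" "0 < v 0"
    and "exactly_sign_changes u m" "exactly_sign_changes v m"
  shows "v 0 \<le> u 0"
proof (rule ccontr)
  assume "\<not> ?thesis"
  then have less: "u 0 < v 0" by simp
  have alt: "at_least_sign_changes w k = alternations_from w 0 k" for w k
    by (simp add: at_least_sign_changes_def alternations_from_def)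
  show False
    by (rule different_alternations[OF u v order_refl order_refl _ _ initial_value[OF u assms(3)] less, of m])
      (use u v assms(5,6) less initial_value[OF u assms(3)] in
        \<open>auto simp: solves_def exactly_sign_changes_def alt intro: G_mono\<close>)
qed

lemma solves_if_radial_solution:
  assumes "radial_solution n f u"
  obtains u1 where "solves u u1"
proof -
  obtain u1 u2 where u:
      "\<And>r. 0 \<le> r \<Longrightarrow> (u has_real_derivative u1 r) (at r within {0..})"
      "\<And>r. 0 \<le> r \<Longrightarrow> (u1 has_real_derivative u2 r) (at r within {0..})"
      "\<And>r. 0 < r \<Longrightarrow> u2 r + (real n - 1) / r * u1 r + f (u r) = 0"
      "u1 0 = 0" "(u \<longlongrightarrow> 0) at_top"
    using assms unfolding radial_solution_def by blast
  have "solves u u1" unfolding solves_def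
  proof (intro conjI allI impI)
    show "continuous_on {0..} u1" using u(2) by (intro DERIV_continuous_on) auto
    fix r :: real assume r: "0 < r"
    have "at r within {0..} = at r" using r by (intro at_within_interior) auto
    moreover have "u2 r = - ((real n - 1) / r * u1 r) - f (u r)" using u(3)[OF r] by linarith
    ultimately show "(u1 has_real_derivative - ((real n - 1) / r * u1 r) - f (u r)) (at r)"
      using u(2)[of r] r by simp
  qed (use u in auto)
  then show ?thesis by (rule that)
qed

end


lemma primitive_deriv:
  assumes "continuous_on UNIV f"
  shows "(primitive f has_real_derivative f s) (at s)"
proof -
  define a where "a = - \<bar>s\<bar> - 1"
  have "(primitive f has_vector_derivative f s) (at s within {a..-a})"
    unfolding primitive_def[abs_def]
    by (rule interval_integral_FTC2) (auto simp: a_def intro: continuous_on_subset[OF assms])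
  then have "(primitive f has_real_derivative f s) (at s within {a..-a})"
    by (simp add: has_real_derivative_iff_has_vector_derivative)
  moreover have "at s within {a..-a} = at s"
    by (rule at_within_Icc_at) (auto simp: a_def)
  ultimately show ?thesis by simp
qed

theorem theorem1p1:
  fixes n k :: nat and f :: "real \<Rightarrow> real" and b \<beta> :: real
  assumes "1 < n" "n \<le> 4" and "1 \<le> k"
    and "continuous_on UNIV f"
    and "\<And>s. f (- s) = - f s"
    and "f 0 = 0"
    and "0 < b" "b < \<beta>"
    and "\<And>s. b < s \<Longrightarrow> 0 < f s"
    and "\<And>s. s \<in> {0..b} \<Longrightarrow> f s \<le> 0"
    and "\<exists>s\<in>{0..b}. f s \<noteq> 0"
    and "primitive f \<beta> = 0"
    and "f C1_differentiable_on {0<..}"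
    and "set_integrable lborel {0<..<1} (deriv f)"
    and "\<And>s. \<beta> < s \<Longrightarrow> deriv (\<lambda>t. primitive f t / f t) s \<ge> (real n - 2) / 2"
  shows "\<forall>u v. radial_solution n f u \<and> u 0 > 0 \<and> exactly_sign_changes u (k - 1) \<and>
               radial_solution n f v \<and> v 0 > 0 \<and> exactly_sign_changes v (k - 1)
               \<longrightarrow> (\<forall>r\<ge>0. u r = v r)"
proof -
  let ?F = "primitive f"
  note F' = primitive_deriv[OF assms(4)]
  have F_cont: "continuous_on S ?F" for S
    using DERIV_isCont[OF F'] by (simp add: continuous_at_imp_continuous_on)
  have F0: "?F 0 = 0" by (simp add: primitive_def zero_ereal_def)
  have F_even: "?F (- s) = ?F s" for s
  proof -
    have "((\<lambda>t. ?F (- t) - ?F t) has_real_derivative f (- t) * - 1 - f t) (at t)" for t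
      by (intro DERIV_diff F' DERIV_chain2[OF F']) (auto intro!: derivative_eq_intros)
    then have "\<forall>t. ((\<lambda>t. ?F (- t) - ?F t) has_real_derivative 0) (at t)"
      using assms(5) by simp
    from DERIV_isconst_all[OF this, of s 0] show ?thesis using F0 by simp
  qed
  have F_nonpos: "?F s \<le> 0" if s: "0 \<le> s" "s \<le> \<beta>" for s
  proof (cases "s \<le> b")
    case True
    have "?F s \<le> ?F 0"
      by (rule DERIV_nonpos_imp_decreasing_open[OF s(1) _ F_cont]) (use F' assms(10) True in force)
    then show ?thesis using F0 by simp
  next
    case False
    have "?F s \<le> ?F \<beta>"
      by (rule DERIV_nonneg_imp_increasing_open[OF s(2) _ F_cont])
        (use F' assms(9) False in \<open>force intro: less_imp_le\<close>)
    then show ?thesis using assms(12) by simp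
  qed
  have F_pos: "0 < ?F s" if s: "\<beta> < s" for s
  proof -
    have "?F \<beta> < ?F s"
      by (rule DERIV_pos_imp_increasing_open[OF s _ F_cont]) (use F' assms(8,9) in force)
    then show ?thesis using assms(12) by simp
  qed
  have f_diff: "f differentiable (at s)" if "0 < s" for s
    using assms(13) that unfolding C1_differentiable_on_def
    by (auto simp: has_real_derivative_iff_has_vector_derivative[symmetric] real_differentiable_def)
  interpret radial_ode n f ?F b \<beta>
  proof
    fix s :: real
    show "(?F has_real_derivative f s) (at s)" by (rule F')
    show "?F s \<le> 0" if "\<bar>s\<bar> \<le> \<beta>" using F_nonpos[of s] F_nonpos[of "- s"] F_even[of s] that
      by (cases "0 \<le> s") auto
    show "0 < ?F s" if "\<beta> < \<bar>s\<bar>" using F_pos[of s] F_pos[of "- s"] F_even[of s] that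
      by (cases "0 \<le> s") auto
    show "\<exists>d\<ge>(real n - 2) / 2. ((\<lambda>t. ?F t / f t) has_real_derivative d) (at s)" if s: "\<beta> < s"
    proof -
      have "(\<lambda>t. ?F t / f t) differentiable (at s)"
        using f_diff[of s] F'[of s] assms(7,8) assms(9)[of s] s
        by (intro differentiable_divide) (auto simp: real_differentiable_def)
      then have "((\<lambda>t. ?F t / f t) has_real_derivative deriv (\<lambda>t. ?F t / f t) s) (at s)"
        by (simp add: DERIV_deriv_iff_real_differentiable)
      then show ?thesis using assms(15)[OF s] by blast
    qed
  qed (use assms F_even F0 in auto)
  show ?thesis
  proof (intro allI impI, elim conjE)
    fix u v and r :: real
    assume *: "radial_solution n f u" "u 0 > 0" "exactly_sign_changes u (k - 1)"
      "radial_solution n f v" "v 0 > 0" "exactly_sign_changes v (k - 1)" and r: "0 \<le> r"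
    obtain u1 where u: "solves u u1" using solves_if_radial_solution[OF *(1)] .
    obtain v1 where v: "solves v v1" using solves_if_radial_solution[OF *(4)] .
    have "u 0 = v 0"
      using initial_value_le[OF u v *(2,5,3,6)] initial_value_le[OF v u *(5,2,6,3)] by simp
    then show "u r = v r" by (rule uniqueness[OF u v _ r])
  qed
qed

end
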